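(* Let $\Delta$ be a saturated, contradiction-free higher-order unification context and let $\Gamma=\mathrm{unif}(\Delta)$. Then $\Gamma$ is a most general unifier of $\Delta$.
   Context: Simply typed constructors $c,d,e$, bound variables $x,y,z$, unification metavariables tagged contractive ($H^{\mathrm{con}}$) or recursive ($H^{\mathrm{rec}}$; $m$ ranges over tags), recursion constants $\underline r,\underline s,\underline t$. $\bar x$ a list of pairwise distinct variables (set operations on underlying sets); $[\bar y/\bar x]$ simultaneous renaming; $FV$ free variables; $h$ ranges over constructors and variables. Terms well-typed, $\beta$-normal $\eta$-long except that arguments of metavariables and recursion constants are bare variables; $\lambda$-bound variables up to $\alpha$. Contractive terms $U ::= \lambda\bar x.\,y\,\overline N\mid\lambda\bar x.\,c\,\overline N\mid\lambda\bar x.\,H^{\mathrm{con}}\bar y$; recursive terms $N ::= \lambda\bar x.\,\underline r\,\bar y\mid\lambda\bar x.\,H^{\mathrm{rec}}\bar y$; $M$ either. A unification context $\Delta$: finite collection of equations $U_1\doteq U_2$, $N_1\doteq N_2$, closed definitions $\underline r=_dU$ (at most one per constant, all used constants defined), possibly $\mathrm{contra}$ (contradiction-free if absent); $\mathrm{eqs},\mathrm{defs},UV$ as usual. Expansion: $\mathrm{exp}^\Delta_0=\bot$; $\mathrm{exp}^\Delta_{k+1}(\lambda\bar x.\,H^m\bar y)=\lambda\bar x.\,H^m\bar y$; $\mathrm{exp}^\Delta_{k+1}(\lambda\bar x.\,h\,N_1\cdots N_n)=\lambda\bar x.\,h\,(\mathrm{exp}^\Delta_k(N_1))\cdots(\mathrm{exp}^\Delta_k(N_n))$;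 $\mathrm{exp}^\Delta_{k+1}(\lambda\bar x.\,\underline r\,\bar y)=\mathrm{exp}^\Delta_{k+1}(\lambda\bar x.\,[\bar y/\bar z]U)$ for $\underline r=_d\lambda\bar z.\,U\in\Delta$. $M\doteq M'$ holds if expansions agree at all depths. Substitutions: contradiction-free contexts with equations $H^{\mathrm{con}}\bar x\doteq U$ or $H^{\mathrm{rec}}\bar x\doteq N$, $FV$(right)$\subseteq\bar x$, no top-level $\lambda$ on the right, each metavariable on a left side at most once; $\mathrm{dom}$. $M[\Gamma]$ replaces $H^m\bar y$ by $[\bar y/\bar z]M'$ when $H^m\bar z\doteq M'\in\Gamma$ (commutes with $\lambda$ and heads, fixes $\underline r\,\bar y$). $\Delta[\Gamma]=\mathrm{defs}(\Gamma)\cup\{M[\Gamma]\doteq M'[\Gamma]\}\cup\{\underline r=_dU[\Gamma]\}$ over $\mathrm{eqs}(\Delta)$, $\mathrm{defs}(\Delta)$; $\Gamma_1[\Gamma_2]$ likewise on right sides and definitions of $\Gamma_1$, plus $\mathrm{defs}(\Gamma_2)$; recursion constants renamed apart. $\Gamma_1\circ\Gamma_2=\Gamma_1[\Gamma_2]\cup\{H^m\bar x\doteq M\in\Gamma_2\mid H^m\notin\mathrm{dom}(\Gamma_1)\}$. $\Gamma=\Gamma'$ iff same domain and for each $H^m$ with $\eta$-long form $\lambda\bar x.H^m\bar x$, $\mathrm{exp}^\Gamma_k((\lambda\bar x.H^m\bar x)[\Gamma])=\mathrm{exp}^{\Gamma'}_k((\lambda\bar x.H^m\bar x)[\Gamma'])$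 for all $k$. A unifier of contradiction-free $\Delta$: substitution $\Gamma$ with $\mathrm{dom}(\Gamma)=UV(\Delta)$ and every equation of $\Delta[\Gamma]$ holding in $\Delta[\Gamma]$. $\Gamma_1$ is more general than $\Gamma_2$ if $\Gamma_1\circ\Gamma'=\Gamma_2$ for some $\Gamma'$; a most general unifier is a unifier more general than every unifier. Resolved: $H^{\mathrm{con}}$ is resolved if $\Delta$ contains (either orientation) $H^{\mathrm{con}}\bar y\doteq h\,\overline N$ with $FV(h\,\overline N)\subseteq\bar y$ or $H^{\mathrm{con}}\bar y\doteq G^{\mathrm{con}}\bar w$ with $\bar w\subsetneq\bar y$; $H^{\mathrm{rec}}$ is resolved if it contains $H^{\mathrm{rec}}\bar y\doteq\underline r\,\bar z$ with $\bar z\subseteq\bar y$ or $H^{\mathrm{rec}}\bar y\doteq G^{\mathrm{rec}}\bar w$ with $\bar w\subsetneq\bar y$; such equations are resolution equations. Saturation rules (premises present $\Rightarrow$ add conclusion; $(\exists X)$: $X$ fresh and the rule fires only if no instance of the conclusion is present): U-INST/N-INST: $\lambda\bar x.\,M\doteq\lambda\bar x.\,M'\Rightarrow(\exists\bar x)\,M\doteq M'$. SIMP-F1: $x\,\overline N\doteq c\,\overline{N'}\Rightarrow\mathrm{contra}$. SIMP-F2: $x\,\overline N\doteq y\,\overline{N'}$, $x\ne y\Rightarrow\mathrm{contra}$. SIMP-F3: $c\,\overline N\doteq d\,\overline{N'}$, $c\ne d\Rightarrow\mathrm{contra}$. SIMP: $h\,N_1\cdots N_n\doteq h\,N'_1\cdots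 N'_n\Rightarrow N_i\doteq N'_i$. PROJ-F: $H^{\mathrm{con}}\bar y\doteq z\,\overline N$, $z\notin\bar y\Rightarrow\mathrm{contra}$. IMIT: $H^{\mathrm{con}}\bar y\doteq c\,\overline N$, $H^{\mathrm{con}}$ unresolved $\Rightarrow(\exists G^{\mathrm{rec}}_1..G^{\mathrm{rec}}_n)\,H^{\mathrm{con}}\bar y\doteq c\,(\lambda\bar w_1.\,G^{\mathrm{rec}}_1\bar y\bar w_1)\cdots(\lambda\bar w_n.\,G^{\mathrm{rec}}_n\bar y\bar w_n)$. PROJ: same with head $y_i$ for premise $H^{\mathrm{con}}\bar y\doteq y_i\,\overline N$, $y_i\in\bar y$. PRUNE: $H^{\mathrm{rec}}\bar y\doteq\underline r\,\bar x$, $\bar x\not\subseteq\bar y$, $\bar w=\bar x\cap\bar y$, $H^{\mathrm{rec}}$ unresolved $\Rightarrow(\exists\underline t)(\exists G^{\mathrm{con}})\,H^{\mathrm{rec}}\bar y\doteq\underline t\,\bar w,\ \underline r\,\bar x\doteq\underline t\,\bar w,\ \underline t=_d\lambda\bar w.\,G^{\mathrm{con}}\bar w$. FF-D: $G^m\bar x\doteq H^m\bar y$, $G^m\ne H^m$, $\bar z=\bar x\cap\bar y$, $\bar x\not\subseteq\bar y$, $\bar y\not\subseteq\bar x$, one unresolved $\Rightarrow(\exists F^m)\,G^m\bar x\doteq F^m\bar z,\ H^m\bar y\doteq F^m\bar z$. FF-S: $G^m\bar x\doteq G^m\bar y$, $\bar x\ne\bar y$, $\bar z=\{x_i\mid x_i=y_i\}$,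 $G^m$ unresolved $\Rightarrow(\exists F^m)\,G^m\bar x\doteq F^m\bar z,\ G^m\bar y\doteq F^m\bar z$. REC-EXP: $\underline r\,\bar x\doteq\underline s\,\bar y$, $\underline r=_d\lambda\bar z.\,U_1$, $\underline s=_d\lambda\bar w.\,U_2\Rightarrow[\bar x/\bar z]U_1\doteq[\bar y/\bar w]U_2$. U-AGREE/N-AGREE: $H^m\bar x\doteq M_1$, $H^m\bar y\doteq M_2$, $FV(M_1)\subseteq\bar x$, $FV(M_2)\subseteq\bar y\Rightarrow M_1\doteq[\bar x/\bar y]M_2$. Symmetry and transitivity of $\doteq$ on contractive and on recursive terms. $\Delta$ is saturated if no rule adds anything new. Construction of $\mathrm{unif}(\Delta)$: choose one resolution equation for each resolved metavariable. Unresolved metavariables form equivalence classes under $\doteq$; for each class choose a representative $G^m$ and for each $H^m$ in the class a representative equation $H^m\bar y\doteq G^m\bar z$ in $\Delta$ with $\bar z$ a permutation of $\bar y$, such that all members of a class use the same right-hand side $G^m\bar z$. Replacing $H^m$ in a term by its resolution $H^m\bar y\doteq M$ (resp. representative equation $H^m\bar y\doteq G^m\bar z$) means replacing each occurrence $H^m\bar x$ by $[\bar x/\bar y]M$ (resp. $[\bar x/\bar y](G^m\bar z)$). Then: (1) start with all recursive definitions of $\Delta$; (2) add the resolution equation of each resolved metavariable in $UV(\Delta)$; (3) add the representative equation of each unresolved one; (4) in right-hand sides and definition bodies repeatedly replace resolved metavariables by their resolutions and unresolved ones by their representatives until only representative metavariables remain. *)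

theory Defs
  imports Main
begin

(* Every simple type T1 -> ... -> Tn -> b is uniquely of the form Ty [T1,...,Tn] b. *)
datatype 'b ty = Ty (doms: "'b ty list") (cod: 'b)

(* Con for contractive, Recu for recursive *)
datatype tag = Con | Recu

datatype 'b mvar = MVar (mname: nat) (mtag: tag) (mty: "'b ty")

datatype 'b rconst = RConst (rname: nat) (rty: "'b ty")

(* Locally nameless: the variables occurring free in equations are named (and carry their
   type), lambda-bound variables are indices, so that alpha-equivalence is equality.
   A binder list \<lambda>x1...xn is one block: inside it, x1,...,xn are Bound 0,...,Bound (n-1) and
   the variable that is Bound j outside the block becomes Bound (n+j). *)
datatype 'b var = Free nat "'b ty" | Bound nat

datatype ('b, 'c) head = HVar "'b var" | HCon 'c

(* App Ts h [N1,...,Nn] is \<lambda>xs. h N1 ... Nn, Meta Ts H ys is \<lambda>xs. H ys and Rec Ts r ys is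
   \<lambda>xs. r ys, where Ts lists the types of the bound variables xs. *)
datatype ('b, 'c) trm =
    App "'b ty list" "('b, 'c) head" "('b, 'c) trm list"
  | Meta "'b ty list" "'b mvar" "'b var list"
  | Rec "'b ty list" "'b rconst" "'b var list"

fun binders :: "('b, 'c) trm \<Rightarrow> 'b ty list" where
  "binders (App Ts h Ns) = Ts"
| "binders (Meta Ts H ys) = Ts"
| "binders (Rec Ts r ys) = Ts"

fun set_binders :: "'b ty list \<Rightarrow> ('b, 'c) trm \<Rightarrow> ('b, 'c) trm" where
  "set_binders Ts (App _ h Ns) = App Ts h Ns"
| "set_binders Ts (Meta _ H ys) = Meta Ts H ys"
| "set_binders Ts (Rec _ r ys) = Rec Ts r ys"

definition frees :: "'b var set \<Rightarrow> 'b var set" where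
  "frees V = {v \<in> V. \<exists>n T. v = Free n T}"

fun fv_head :: "('b, 'c) head \<Rightarrow> 'b var set" where
  "fv_head (HVar v) = frees {v}"
| "fv_head (HCon c) = {}"

fun fv :: "('b, 'c) trm \<Rightarrow> 'b var set" where
  "fv (App Ts h Ns) = fv_head h \<union> (\<Union>N\<in>set Ns. fv N)"
| "fv (Meta Ts H ys) = frees (set ys)"
| "fv (Rec Ts r ys) = frees (set ys)"

fun mvs :: "('b, 'c) trm \<Rightarrow> 'b mvar set" where
  "mvs (App Ts h Ns) = (\<Union>N\<in>set Ns. mvs N)"
| "mvs (Meta Ts H ys) = {H}"
| "mvs (Rec Ts r ys) = {}"

fun rcs :: "('b, 'c) trm \<Rightarrow> 'b rconst set" where
  "rcs (App Ts h Ns) = (\<Union>N\<in>set Ns. rcs N)"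
| "rcs (Meta Ts H ys) = {}"
| "rcs (Rec Ts r ys) = {r}"


subsection \<open>Well-formed terms\<close>

fun var_ty :: "'b ty list \<Rightarrow> 'b var \<Rightarrow> 'b ty option" where
  "var_ty E (Free n T) = Some T"
| "var_ty E (Bound i) = (if i < length E then Some (E ! i) else None)"

fun head_ty :: "('c \<Rightarrow> 'b ty) \<Rightarrow> 'b ty list \<Rightarrow> ('b, 'c) head \<Rightarrow> 'b ty option" where
  "head_ty sig E (HVar v) = var_ty E v"
| "head_ty sig E (HCon c) = Some (sig c)"

definition vars_of_types :: "'b ty list \<Rightarrow> 'b var list \<Rightarrow> 'b ty list \<Rightarrow> bool" where
  "vars_of_types E ys Ts \<longleftrightarrow> distinct ys \<and> map (var_ty E) ys = map Some Ts"

(* wt sig E m M T: M is a well-typed beta-normal eta-long term of type T, contractive for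
   m = Con and recursive for m = Recu; E types the dangling indices of M.  Heads,
   metavariables and recursion constants are fully applied. *)
inductive wt :: "('c \<Rightarrow> 'b ty) \<Rightarrow> 'b ty list \<Rightarrow> tag \<Rightarrow> ('b, 'c) trm \<Rightarrow> 'b ty \<Rightarrow> bool"
  for sig where
  wt_App: "head_ty sig (Ts @ E) h = Some (Ty Ss b) \<Longrightarrow> list_all2 (wt sig (Ts @ E) Recu) Ns Ss
     \<Longrightarrow> wt sig E Con (App Ts h Ns) (Ty Ts b)"
| wt_Meta: "mty H = Ty Ss b \<Longrightarrow> vars_of_types (Ts @ E) ys Ss
     \<Longrightarrow> wt sig E (mtag H) (Meta Ts H ys) (Ty Ts b)"
| wt_Rec: "rty r = Ty Ss b \<Longrightarrow> vars_of_types (Ts @ E) ys Ss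
     \<Longrightarrow> wt sig E Recu (Rec Ts r ys) (Ty Ts b)"


subsection \<open>Renaming of variables\<close>

fun shift :: "nat \<Rightarrow> 'b var \<Rightarrow> 'b var" where
  "shift n (Free k T) = Free k T"
| "shift n (Bound i) = Bound (n + i)"

fun lift :: "nat \<Rightarrow> ('b var \<Rightarrow> 'b var) \<Rightarrow> 'b var \<Rightarrow> 'b var" where
  "lift n f (Free k T) = shift n (f (Free k T))"
| "lift n f (Bound i) = (if i < n then Bound i else shift n (f (Bound (i - n))))"

fun ren_head :: "('b var \<Rightarrow> 'b var) \<Rightarrow> ('b, 'c) head \<Rightarrow> ('b, 'c) head" where
  "ren_head f (HVar v) = HVar (f v)"
| "ren_head f (HCon c) = HCon c"

fun ren :: "('b var \<Rightarrow> 'b var) \<Rightarrow> ('b, 'c) trm \<Rightarrow> ('b, 'c) trm" where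
  "ren f (App Ts h Ns) =
     App Ts (ren_head (lift (length Ts) f) h) (map (ren (lift (length Ts) f)) Ns)"
| "ren f (Meta Ts H ys) = Meta Ts H (map (lift (length Ts) f) ys)"
| "ren f (Rec Ts r ys) = Rec Ts r (map (lift (length Ts) f) ys)"

(* [ys/xs] M, for xs a list of distinct free variables *)
definition rename :: "'b var list \<Rightarrow> 'b var list \<Rightarrow> ('b, 'c) trm \<Rightarrow> ('b, 'c) trm" where
  "rename ys xs M =
     ren (\<lambda>v. case map_of (zip xs ys) v of Some w \<Rightarrow> w | None \<Rightarrow> v) M"

(* [ys/zs] M for the term \<lambda>zs. M, where zs is the whole binder block *)
definition instantiate :: "('b, 'c) trm \<Rightarrow> 'b var list \<Rightarrow> ('b, 'c) trm" where
  "instantiate M ys =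
     ren (\<lambda>v. case v of Free k T \<Rightarrow> Free k T
            | Bound i \<Rightarrow> if i < length ys then ys ! i else Bound (i - length ys))
       (set_binders [] M)"


subsection \<open>Unification contexts\<close>

record ('b, 'c) ctx =
  eqs :: "(('b, 'c) trm \<times> ('b, 'c) trm) set"
  defs :: "'b rconst \<Rightarrow> ('b, 'c) trm option"
  contra :: bool

definition ctx_rcs :: "('b, 'c) ctx \<Rightarrow> 'b rconst set" where
  "ctx_rcs \<Delta> = (\<Union>(M, M')\<in>eqs \<Delta>. rcs M \<union> rcs M') \<union> (\<Union>U\<in>ran (defs \<Delta>). rcs U)"

definition UV :: "('b, 'c) ctx \<Rightarrow> 'b mvar set" where
  "UV \<Delta> = (\<Union>(M, M')\<in>eqs \<Delta>. mvs M \<union> mvs M') \<union> (\<Union>U\<in>ran (defs \<Delta>). mvs U)"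

definition wf_ctx :: "('c \<Rightarrow> 'b ty) \<Rightarrow> ('b, 'c) ctx \<Rightarrow> bool" where
  "wf_ctx sig \<Delta> \<longleftrightarrow>
     finite (eqs \<Delta>) \<and> finite (dom (defs \<Delta>)) \<and>
     (\<forall>(M, M')\<in>eqs \<Delta>. \<exists>m T. wt sig [] m M T \<and> wt sig [] m M' T) \<and>
     (\<forall>r U. defs \<Delta> r = Some U \<longrightarrow> wt sig [] Con U (rty r) \<and> fv U = {}) \<and>
     ctx_rcs \<Delta> \<subseteq> dom (defs \<Delta>)"


subsection \<open>Expansion\<close>

datatype ('b, 'c) etrm =
    EBot
  | EApp "'b ty list" "('b, 'c) head" "('b, 'c) etrm list"
  | EMeta "'b ty list" "'b mvar" "'b var list"

fun unfold :: "('b rconst \<Rightarrow> ('b, 'c) trm option) \<Rightarrow> ('b, 'c) trm \<Rightarrow> ('b, 'c) trm" where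
  "unfold D (Rec Ts r ys) =
     (case D r of Some U \<Rightarrow> set_binders Ts (instantiate U ys) | None \<Rightarrow> Rec Ts r ys)"
| "unfold D M = M"

(* Definition bodies are contractive, so one unfolding exposes a head or a metavariable: the
   Rec branch is never taken in a well-formed context. *)
primrec expand :: "('b, 'c) ctx \<Rightarrow> nat \<Rightarrow> ('b, 'c) trm \<Rightarrow> ('b, 'c) etrm" where
  "expand \<Delta> 0 = (\<lambda>M. EBot)"
| "expand \<Delta> (Suc k) = (\<lambda>M. case unfold (defs \<Delta>) M of
       App Ts h Ns \<Rightarrow> EApp Ts h (map (expand \<Delta> k) Ns)
     | Meta Ts H ys \<Rightarrow> EMeta Ts H ys
     | Rec Ts r ys \<Rightarrow> EBot)"

definition holds_in :: "('b, 'c) ctx \<Rightarrow> ('b, 'c) trm \<Rightarrow> ('b, 'c) trm \<Rightarrow> bool" where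
  "holds_in \<Delta> M M' \<longleftrightarrow> (\<forall>k. expand \<Delta> k M = expand \<Delta> k M')"


subsection \<open>Substitutions\<close>

definition is_subst :: "('c \<Rightarrow> 'b ty) \<Rightarrow> ('b, 'c) ctx \<Rightarrow> bool" where
  "is_subst sig \<Gamma> \<longleftrightarrow> wf_ctx sig \<Gamma> \<and> \<not> contra \<Gamma> \<and>
     (\<forall>(L, R)\<in>eqs \<Gamma>. \<exists>H xs. L = Meta [] H xs \<and> fv R \<subseteq> set xs \<and> binders R = []) \<and>
     (\<forall>H xs R xs' R'. (Meta [] H xs, R) \<in> eqs \<Gamma> \<and> (Meta [] H xs', R') \<in> eqs \<Gamma>
        \<longrightarrow> xs = xs' \<and> R = R')"

definition sdom :: "('b, 'c) ctx \<Rightarrow> 'b mvar set" where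
  "sdom \<Gamma> = {H. \<exists>xs R. (Meta [] H xs, R) \<in> eqs \<Gamma>}"

definition lookup :: "('b, 'c) ctx \<Rightarrow> 'b mvar \<Rightarrow> ('b var list \<times> ('b, 'c) trm) option" where
  "lookup \<Gamma> H = (if H \<in> sdom \<Gamma> then Some (THE (xs, R). (Meta [] H xs, R) \<in> eqs \<Gamma>) else None)"

(* Simultaneously replaces every occurrence of H ys by [ys/zs] R when \<sigma> H = Some (zs, R). *)
fun replace :: "('b mvar \<Rightarrow> ('b var list \<times> ('b, 'c) trm) option) \<Rightarrow> ('b, 'c) trm \<Rightarrow> ('b, 'c) trm"
  where
  "replace \<sigma> (App Ts h Ns) = App Ts h (map (replace \<sigma>) Ns)"
| "replace \<sigma> (Meta Ts H ys) =
     (case \<sigma> H of Some (zs, R) \<Rightarrow> set_binders Ts (rename ys zs R) | None \<Rightarrow> Meta Ts H ys)"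
| "replace \<sigma> (Rec Ts r ys) = Rec Ts r ys"

definition subst :: "('b, 'c) ctx \<Rightarrow> ('b, 'c) trm \<Rightarrow> ('b, 'c) trm" where
  "subst \<Gamma> = replace (lookup \<Gamma>)"

fun map_rcs :: "('b rconst \<Rightarrow> 'b rconst) \<Rightarrow> ('b, 'c) trm \<Rightarrow> ('b, 'c) trm" where
  "map_rcs f (App Ts h Ns) = App Ts h (map (map_rcs f) Ns)"
| "map_rcs f (Meta Ts H ys) = Meta Ts H ys"
| "map_rcs f (Rec Ts r ys) = Rec Ts (f r) ys"

(* The recursion constants of \<Gamma> are renamed apart from those of \<Delta> by increasing their names
   beyond all names defined in \<Delta>. *)
definition rename_apart :: "('b, 'c) ctx \<Rightarrow> ('b, 'c) ctx \<Rightarrow> ('b, 'c) ctx" where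
  "rename_apart \<Delta> \<Gamma> =
     (let N = Suc (Max (insert 0 (rname ` dom (defs \<Delta>))));
          f = (\<lambda>r. RConst (N + rname r) (rty r))
      in \<lparr> eqs = {(map_rcs f M, map_rcs f M') |M M'. (M, M') \<in> eqs \<Gamma>},
           defs = (\<lambda>r. if N \<le> rname r
                       then map_option (map_rcs f) (defs \<Gamma> (RConst (rname r - N) (rty r)))
                       else None),
           contra = contra \<Gamma> \<rparr>)"

definition subst_ctx :: "('b, 'c) ctx \<Rightarrow> ('b, 'c) ctx \<Rightarrow> ('b, 'c) ctx" where
  "subst_ctx \<Delta> \<Gamma> =
     (let \<Gamma>' = rename_apart \<Delta> \<Gamma>
      in \<lparr> eqs = {(subst \<Gamma>' M, subst \<Gamma>' M') |M M'. (M, M') \<in> eqs \<Delta>},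
           defs = defs \<Gamma>' ++ (\<lambda>r. map_option (subst \<Gamma>') (defs \<Delta> r)),
           contra = contra \<Delta> \<rparr>)"

definition compose :: "('b, 'c) ctx \<Rightarrow> ('b, 'c) ctx \<Rightarrow> ('b, 'c) ctx" where
  "compose \<Gamma>1 \<Gamma>2 =
     (let \<Gamma>2' = rename_apart \<Gamma>1 \<Gamma>2
      in \<lparr> eqs = {(L, subst \<Gamma>2' R) |L R. (L, R) \<in> eqs \<Gamma>1}
             \<union> {(Meta [] H xs, R) |H xs R. (Meta [] H xs, R) \<in> eqs \<Gamma>2' \<and> H \<notin> sdom \<Gamma>1},
           defs = defs \<Gamma>2' ++ (\<lambda>r. map_option (subst \<Gamma>2') (defs \<Gamma>1 r)),
           contra = False \<rparr>)"

definition eta_long :: "'b mvar \<Rightarrow> ('b, 'c) trm" where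
  "eta_long H = Meta (doms (mty H)) H (map Bound [0..<length (doms (mty H))])"

definition subst_eq :: "('b, 'c) ctx \<Rightarrow> ('b, 'c) ctx \<Rightarrow> bool" where
  "subst_eq \<Gamma> \<Gamma>' \<longleftrightarrow> sdom \<Gamma> = sdom \<Gamma>' \<and>
     (\<forall>H k. expand \<Gamma> k (subst \<Gamma> (eta_long H)) = expand \<Gamma>' k (subst \<Gamma>' (eta_long H)))"

definition unifier :: "('c \<Rightarrow> 'b ty) \<Rightarrow> ('b, 'c) ctx \<Rightarrow> ('b, 'c) ctx \<Rightarrow> bool" where
  "unifier sig \<Delta> \<Gamma> \<longleftrightarrow> \<not> contra \<Delta> \<and> is_subst sig \<Gamma> \<and> sdom \<Gamma> = UV \<Delta> \<and>
     (\<forall>(M, M')\<in>eqs (subst_ctx \<Delta> \<Gamma>). holds_in (subst_ctx \<Delta> \<Gamma>) M M')"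

definition more_general :: "('c \<Rightarrow> 'b ty) \<Rightarrow> ('b, 'c) ctx \<Rightarrow> ('b, 'c) ctx \<Rightarrow> bool" where
  "more_general sig \<Gamma>1 \<Gamma>2 \<longleftrightarrow> (\<exists>\<Gamma>'. is_subst sig \<Gamma>' \<and> subst_eq (compose \<Gamma>1 \<Gamma>') \<Gamma>2)"

definition most_general_unifier :: "('c \<Rightarrow> 'b ty) \<Rightarrow> ('b, 'c) ctx \<Rightarrow> ('b, 'c) ctx \<Rightarrow> bool" where
  "most_general_unifier sig \<Delta> \<Gamma> \<longleftrightarrow> unifier sig \<Delta> \<Gamma> \<and>
     (\<forall>\<Gamma>'. unifier sig \<Delta> \<Gamma>' \<longrightarrow> more_general sig \<Gamma> \<Gamma>')"


subsection \<open>Saturation\<close>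

(* H ys = M is a resolution equation of \<Delta> for H *)
definition resolution :: "('b, 'c) ctx \<Rightarrow> 'b mvar \<Rightarrow> 'b var list \<Rightarrow> ('b, 'c) trm \<Rightarrow> bool" where
  "resolution \<Delta> H ys M \<longleftrightarrow>
     ((Meta [] H ys, M) \<in> eqs \<Delta> \<or> (M, Meta [] H ys) \<in> eqs \<Delta>) \<and>
     (case mtag H of
        Con \<Rightarrow> (\<exists>h Ns. M = App [] h Ns \<and> fv M \<subseteq> set ys) \<or>
               (\<exists>G ws. M = Meta [] G ws \<and> mtag G = Con \<and> set ws \<subset> set ys)
      | Recu \<Rightarrow> (\<exists>r zs. M = Rec [] r zs \<and> set zs \<subseteq> set ys) \<or>
                (\<exists>G ws. M = Meta [] G ws \<and> mtag G = Recu \<and> set ws \<subset> set ys))"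

definition resolved :: "('b, 'c) ctx \<Rightarrow> 'b mvar \<Rightarrow> bool" where
  "resolved \<Delta> H \<longleftrightarrow> (\<exists>ys M. resolution \<Delta> H ys M)"

datatype ('b, 'c) item =
    Eqn "('b, 'c) trm" "('b, 'c) trm"
  | Dfn "'b rconst" "('b, 'c) trm"
  | Contra

definition items :: "('b, 'c) ctx \<Rightarrow> ('b, 'c) item set" where
  "items \<Delta> = {Eqn M M' |M M'. (M, M') \<in> eqs \<Delta>} \<union> {Dfn r U |r U. defs \<Delta> r = Some U}
     \<union> (if contra \<Delta> then {Contra} else {})"

(* h (\<lambda>ws1. G1 ys ws1) ... (\<lambda>wsn. Gn ys wsn), where wsi are as in the binder of Ni *)
definition imitation ::
  "('b, 'c) head \<Rightarrow> 'b var list \<Rightarrow> ('b, 'c) trm list \<Rightarrow> 'b mvar list \<Rightarrow> ('b, 'c) trm" where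
  "imitation h ys Ns Gs = App [] h
     (map2 (\<lambda>N G. Meta (binders N) G (ys @ map Bound [0..<length (binders N)])) Ns Gs)"

(* rule \<Delta> C: the premises of an instance of a saturation rule are present in \<Delta>, and C is the
   set of all instances of its conclusion, each one a set of items (C is a singleton unless
   the conclusion is existentially quantified).  Lists ws, zs that are only given as sets may
   be enumerated in any order.  In rule inst (U-INST and N-INST) the instances open the
   binders with distinct variables that are not free in the premise. *)
inductive rule :: "('b, 'c) ctx \<Rightarrow> ('b, 'c) item set set \<Rightarrow> bool" for \<Delta> where
  inst: "(M, M') \<in> eqs \<Delta> \<Longrightarrow>
     rule \<Delta> {{Eqn (instantiate M xs) (instantiate M' xs)} |xs.
       vars_of_types [] xs (binders M) \<and> set xs \<inter> (fv M \<union> fv M') = {}}"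
| simp_f1: "(App [] (HVar x) Ns, App [] (HCon c) Ns') \<in> eqs \<Delta> \<Longrightarrow> rule \<Delta> {{Contra}}"
| simp_f2: "(App [] (HVar x) Ns, App [] (HVar y) Ns') \<in> eqs \<Delta> \<Longrightarrow> x \<noteq> y \<Longrightarrow>
     rule \<Delta> {{Contra}}"
| simp_f3: "(App [] (HCon c) Ns, App [] (HCon d) Ns') \<in> eqs \<Delta> \<Longrightarrow> c \<noteq> d \<Longrightarrow>
     rule \<Delta> {{Contra}}"
| simp: "(App [] h Ns, App [] h Ns') \<in> eqs \<Delta> \<Longrightarrow> length Ns = length Ns' \<Longrightarrow> i < length Ns \<Longrightarrow>
     rule \<Delta> {{Eqn (Ns ! i) (Ns' ! i)}}"
| proj_f: "(Meta [] H ys, App [] (HVar z) Ns) \<in> eqs \<Delta> \<Longrightarrow> mtag H = Con \<Longrightarrow> z \<notin> set ys \<Longrightarrow>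
     rule \<Delta> {{Contra}}"
| imit: "(Meta [] H ys, App [] (HCon c) Ns) \<in> eqs \<Delta> \<Longrightarrow> mtag H = Con \<Longrightarrow> \<not> resolved \<Delta> H \<Longrightarrow>
     rule \<Delta> {{Eqn (Meta [] H ys) (imitation (HCon c) ys Ns Gs)} |Gs.
       length Gs = length Ns \<and> (\<forall>G\<in>set Gs. mtag G = Recu)}"
| proj: "(Meta [] H ys, App [] (HVar y) Ns) \<in> eqs \<Delta> \<Longrightarrow> mtag H = Con \<Longrightarrow> y \<in> set ys \<Longrightarrow>
     \<not> resolved \<Delta> H \<Longrightarrow>
     rule \<Delta> {{Eqn (Meta [] H ys) (imitation (HVar y) ys Ns Gs)} |Gs.
       length Gs = length Ns \<and> (\<forall>G\<in>set Gs. mtag G = Recu)}"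
| prune: "(Meta [] H ys, Rec [] r xs) \<in> eqs \<Delta> \<Longrightarrow> mtag H = Recu \<Longrightarrow> \<not> set xs \<subseteq> set ys \<Longrightarrow>
     \<not> resolved \<Delta> H \<Longrightarrow>
     rule \<Delta> {{Eqn (Meta [] H ys) (Rec [] t ws), Eqn (Rec [] r xs) (Rec [] t ws),
             Dfn t (Meta Ts G (map Bound [0..<length ws]))} |t G ws Ts.
       mtag G = Con \<and> vars_of_types [] ws Ts \<and> set ws = set xs \<inter> set ys}"
| ff_d: "(Meta [] G xs, Meta [] H ys) \<in> eqs \<Delta> \<Longrightarrow> mtag G = mtag H \<Longrightarrow> G \<noteq> H \<Longrightarrow>
     \<not> set xs \<subseteq> set ys \<Longrightarrow> \<not> set ys \<subseteq> set xs \<Longrightarrow> \<not> resolved \<Delta> G \<or> \<not> resolved \<Delta> H \<Longrightarrow>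
     rule \<Delta> {{Eqn (Meta [] G xs) (Meta [] F zs), Eqn (Meta [] H ys) (Meta [] F zs)} |F zs.
       mtag F = mtag G \<and> distinct zs \<and> set zs = set xs \<inter> set ys}"
| ff_s: "(Meta [] G xs, Meta [] G ys) \<in> eqs \<Delta> \<Longrightarrow> xs \<noteq> ys \<Longrightarrow> \<not> resolved \<Delta> G \<Longrightarrow>
     rule \<Delta> {{Eqn (Meta [] G xs) (Meta [] F zs), Eqn (Meta [] G ys) (Meta [] F zs)} |F zs.
       mtag F = mtag G \<and> distinct zs \<and> set zs = {x. (x, x) \<in> set (zip xs ys)}}"
| rec_exp: "(Rec [] r xs, Rec [] s ys) \<in> eqs \<Delta> \<Longrightarrow> defs \<Delta> r = Some U1 \<Longrightarrow> defs \<Delta> s = Some U2 \<Longrightarrow>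
     rule \<Delta> {{Eqn (instantiate U1 xs) (instantiate U2 ys)}}"
| agree: "(Meta [] H xs, M1) \<in> eqs \<Delta> \<Longrightarrow> (Meta [] H ys, M2) \<in> eqs \<Delta> \<Longrightarrow>
     fv M1 \<subseteq> set xs \<Longrightarrow> fv M2 \<subseteq> set ys \<Longrightarrow> rule \<Delta> {{Eqn M1 (rename xs ys M2)}}"
| sym: "(M, M') \<in> eqs \<Delta> \<Longrightarrow> rule \<Delta> {{Eqn M' M}}"
| trans: "(M, M') \<in> eqs \<Delta> \<Longrightarrow> (M', M'') \<in> eqs \<Delta> \<Longrightarrow> rule \<Delta> {{Eqn M M''}}"

(* A rule adds something new iff no instance of its conclusion is already present: an
   existential rule fires only in that case, and then with fresh symbols. *)
definition saturated :: "('b, 'c) ctx \<Rightarrow> bool" where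
  "saturated \<Delta> \<longleftrightarrow> \<not> (\<exists>C. rule \<Delta> C \<and> \<not> (\<exists>X\<in>C. X \<subseteq> items \<Delta>))"


subsection \<open>The construction of unif\<close>

definition unresolved :: "('b, 'c) ctx \<Rightarrow> 'b mvar set" where
  "unresolved \<Delta> = {H \<in> UV \<Delta>. \<not> resolved \<Delta> H}"

(* Reflexivity is added because a metavariable may occur only inside definition bodies, hence
   in no equation. *)
definition mv_equiv :: "('b, 'c) ctx \<Rightarrow> 'b mvar rel" where
  "mv_equiv \<Delta> = {(H, G). H \<in> unresolved \<Delta> \<and> G \<in> unresolved \<Delta> \<and>
     (H = G \<or> (\<exists>ys zs. (Meta [] H ys, Meta [] G zs) \<in> eqs \<Delta>))}"

(* \<rho> H = Some (ys, M) records the equation H ys = M chosen for H, and R is the set of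
   representatives.  The representative equation of a representative G is G zs = G zs, which
   need not be in \<Delta> (see mv_equiv). *)
definition unif_choice ::
  "('b, 'c) ctx \<Rightarrow> ('b mvar \<Rightarrow> ('b var list \<times> ('b, 'c) trm) option) \<Rightarrow> 'b mvar set \<Rightarrow> bool" where
  "unif_choice \<Delta> \<rho> R \<longleftrightarrow>
     dom \<rho> = UV \<Delta> \<and>
     (\<forall>H\<in>UV \<Delta>. resolved \<Delta> H \<longrightarrow> (\<exists>ys M. \<rho> H = Some (ys, M) \<and> resolution \<Delta> H ys M)) \<and>
     R \<subseteq> unresolved \<Delta> \<and>
     (\<forall>K\<in>unresolved \<Delta> // mv_equiv \<Delta>. \<exists>G zs. K \<inter> R = {G} \<and>
        (\<forall>H\<in>K. \<exists>ys. \<rho> H = Some (ys, Meta [] G zs) \<and> distinct ys \<and> distinct zs \<and> set zs = set ys \<and>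
           ((Meta [] H ys, Meta [] G zs) \<in> eqs \<Delta> \<or>
            (H = G \<and> ys = zs \<and> vars_of_types [] zs (doms (mty G))))))"

definition unif_start ::
  "('b, 'c) ctx \<Rightarrow> ('b mvar \<Rightarrow> ('b var list \<times> ('b, 'c) trm) option) \<Rightarrow> ('b, 'c) ctx" where
  "unif_start \<Delta> \<rho> =
     \<lparr> eqs = {(Meta [] H ys, M) |H ys M. \<rho> H = Some (ys, M)}, defs = defs \<Delta>, contra = False \<rparr>"

definition replace_round ::
  "('b mvar \<Rightarrow> ('b var list \<times> ('b, 'c) trm) option) \<Rightarrow> ('b, 'c) ctx \<Rightarrow> ('b, 'c) ctx" where
  "replace_round \<rho> \<Gamma> =
     \<lparr> eqs = {(L, replace \<rho> M) |L M. (L, M) \<in> eqs \<Gamma>},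
       defs = (\<lambda>r. map_option (replace \<rho>) (defs \<Gamma> r)),
       contra = contra \<Gamma> \<rparr>"

(* \<Gamma> is a result of the construction, for some choice of resolution and representative
   equations. *)
definition unif :: "('b, 'c) ctx \<Rightarrow> ('b, 'c) ctx \<Rightarrow> bool" where
  "unif \<Delta> \<Gamma> \<longleftrightarrow> (\<exists>\<rho> R n. unif_choice \<Delta> \<rho> R \<and>
     \<Gamma> = (replace_round \<rho> ^^ n) (unif_start \<Delta> \<rho>) \<and>
     (\<forall>(L, M)\<in>eqs \<Gamma>. mvs M \<subseteq> R) \<and> (\<forall>U\<in>ran (defs \<Gamma>). mvs U \<subseteq> R))"

end

(* Write rho for the chosen resolution and representative equations, gamma for the substitution
   unif(Delta), so that applying gamma amounts to applying rho often enough, and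
   gamma (rho M) = gamma M.

   Unifier: by induction on k, all equations of Delta have gamma-instances with equal expansions
   up to depth k.  Saturation (rule agree) keeps an equation in Delta when a side H ys is replaced
   by its rho-instance, and resolution by a metavariable strictly decreases the number of
   arguments.  So after finitely many steps both sides are rigid, recursion constants or
   representatives.  Mixed cases are excluded because they would resolve a representative, two
   representatives are identical, two recursion constants unfold to a contractive equation of
   Delta, and rigid sides have equal heads and arguments to which the induction hypothesis applies.

   Most general: a unifier Theta satisfies the equations in rho, hence expansions in Delta[Theta]
   do not change when M is replaced by rho M, and so by gamma M.  Thus Theta itself is the
   substitution with gamma o Theta = Theta. *)

theory Submission
  imports Defs
begin

subsection \<open>Renaming\<close>

text \<open>Three obstacles shape the proof. Unfolding a recursion constant costs no depth
  (\<open>expand_Rec\<close>), so the induction on depth cannot pay for it; typing does: definition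
  bodies are contractive, hence one unfolding exposes a head or a metavariable and no second
  unfolding follows. Next, \<Gamma> carries the definitions of \<Delta> in instantiated form, so
  \<Delta>[\<Gamma>] contains two copies of every recursion constant, the one of \<Delta> and the
  one of \<Gamma> renamed apart. The induction therefore runs in \<Gamma> alone, and the copies are
  identified only afterwards (\<open>expand_subst_ctx_lower\<close>). Last, the unifier property of
  \<Theta> speaks about \<Delta>[\<Theta>], but generality speaks about the composition of \<Gamma>
  and \<Theta>. A definition body U of \<Delta> becomes U[\<Theta>] in the first context and
  (U[\<Gamma>])[\<Theta>] in the second. Expansions in both contexts agree because these bodies
  already have equal expansions in the first one (\<open>expand_defs_cong\<close>).\<close>

lemma freesD: "v \<in> frees A \<Longrightarrow> v \<in> A"
  by (simp add: frees_def)

lemma inj_shift: "shift n v = shift n w \<longleftrightarrow> v = w"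
  by (cases v; cases w) auto

lemma lift_shift: "lift n f (shift n v) = shift n (f v)"
  by (cases v) auto

lemma lift_comp: "lift n (f \<circ> g) = lift n f \<circ> lift n g"
proof
  fix v
  show "lift n (f \<circ> g) v = (lift n f \<circ> lift n g) v"
    by (cases v) (auto simp: lift_shift)
qed

lemma lift_id: "lift n (\<lambda>v. v) = (\<lambda>v. v)"
proof
  fix v :: "'a var"
  show "lift n (\<lambda>v. v) v = v"
    by (cases v) auto
qed

lemma lift_0: "lift 0 f = f"
proof
  fix v
  have "shift 0 w = w" for w :: "'a var"
    by (cases w) auto
  then show "lift 0 f v = f v"
    by (cases v) auto
qed

lemma ren_head_comp: "ren_head f (ren_head g h) = ren_head (f \<circ> g) h"
  by (cases h) auto

lemma ren_ren: "ren f (ren g M) = ren (f \<circ> g) M"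
  by (induction M arbitrary: f g) (auto simp: lift_comp ren_head_comp)

lemma ren_head_id: "ren_head (\<lambda>v. v) h = h"
  by (cases h) auto

lemma ren_id: "ren (\<lambda>v. v) M = M"
  by (induction M) (auto simp: lift_id ren_head_id map_idI)

lemma set_binders_set_binders [simp]: "set_binders Ts (set_binders Ss M) = set_binders Ts M"
  by (cases M) auto

lemma set_binders_binders [simp]: "set_binders (binders M) M = M"
  by (cases M) auto

lemma binders_set_binders [simp]: "binders (set_binders Ts M) = Ts"
  by (cases M) auto

lemma binders_ren [simp]: "binders (ren f M) = binders M"
  by (cases M) auto

lemma ren_set_binders:
  "ren f (set_binders Ts M) = set_binders Ts (ren (lift (length Ts) f) (set_binders [] M))"
  by (cases M) (auto simp: lift_0)

lemma fv_set_binders [simp]: "fv (set_binders Ts M) = fv M"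
  by (cases M) auto

lemma mvs_set_binders [simp]: "mvs (set_binders Ts M) = mvs M"
  by (cases M) auto

lemma rcs_set_binders [simp]: "rcs (set_binders Ts M) = rcs M"
  by (cases M) auto

lemma mvs_ren [simp]: "mvs (ren f M) = mvs M"
  by (induction M arbitrary: f) auto

lemma rcs_ren [simp]: "rcs (ren f M) = rcs M"
  by (induction M arbitrary: f) auto

lemma fv_Free: "v \<in> fv M \<Longrightarrow> \<exists>n T. v = Free n T"
proof (induction M)
  case (App Ts h Ns)
  then show ?case by (cases h) (auto simp: frees_def)
qed (auto simp: frees_def)

text \<open>Renamings are total functions on variables, yet those used here are injective or
  type-preserving only on variables that a term can contain. This is that set for a well-typed term
  with free variables in \<open>V\<close> and \<open>n\<close> dangling indices; the lemmas on
  \<open>ren\<close> put their hypotheses on it only.\<close>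

definition scope :: "'b var set \<Rightarrow> nat \<Rightarrow> 'b var set" where
  "scope V n = frees V \<union> Bound ` {..<n}"

lemma vars_in_scope:
  "vars_of_types E ys Ts \<Longrightarrow> frees (set ys) \<subseteq> V \<Longrightarrow> v \<in> set ys \<Longrightarrow> v \<in> scope V (length E)"
proof -
  assume a: "vars_of_types E ys Ts" "frees (set ys) \<subseteq> V" "v \<in> set ys"
  then obtain i where "i < length ys" "v = ys ! i" by (auto simp: in_set_conv_nth)
  with a have "var_ty E v \<noteq> None"
    unfolding vars_of_types_def
    by (metis (no_types, lifting) length_map nth_map option.distinct(1))
  with a show ?thesis
    by (cases v) (auto simp: scope_def frees_def split: if_splits)
qed

lemma head_in_scope:
  "head_ty sig E (HVar v) \<noteq> None \<Longrightarrow> frees {v} \<subseteq> V \<Longrightarrow> v \<in> scope V (length E)"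
  by (cases v) (auto simp: scope_def frees_def split: if_splits)

lemma lift_eq_on_scope:
  assumes "\<And>v. v \<in> scope V n \<Longrightarrow> f v = g v" "v \<in> scope V (k + n)"
  shows "lift k f v = lift k g v"
proof (cases v)
  case (Free m T)
  with assms show ?thesis by (auto simp: scope_def)
next
  case (Bound i)
  with assms show ?thesis
    by (auto simp: scope_def frees_def)
qed

lemma inj_on_lift:
  assumes "inj_on f (scope V n)"
  shows "inj_on (lift k f) (scope V (k + n))"
proof (rule inj_onI)
  fix v w
  assume v: "v \<in> scope V (k + n)" and w: "w \<in> scope V (k + n)" and e: "lift k f v = lift k f w"
  \<comment> \<open>Each variable of the larger scope is either an index of the block, which
    \<open>lift\<close> fixes, or a shifted variable of the smaller scope. By \<open>**\<close> the
    two kinds have disjoint images, so injectivity of \<open>f\<close> only has to separate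
    variables of the second kind.\<close>
  have *: "(\<exists>i<k. u = Bound i \<and> lift k f u = Bound i) \<or>
      (\<exists>u'\<in>scope V n. u = shift k u' \<and> lift k f u = shift k (f u'))" if "u \<in> scope V (k + n)" for u
  proof (cases u)
    case (Free m T)
    with that show ?thesis by (intro disjI2 bexI[of _ u]) (auto simp: scope_def)
  next
    case (Bound i)
    show ?thesis
    proof (cases "i < k")
      case False
      with that Bound show ?thesis
        by (intro disjI2 bexI[of _ "Bound (i - k)"]) (auto simp: scope_def frees_def)
    qed (use Bound in auto)
  qed
  have **: "shift k u \<noteq> Bound i" if "i < k" for u :: "'b var" and i
    using that by (cases u) auto
  from *[OF v] show "v = w"
  proof (elim disjE exE bexE conjE)
    fix i assume "i < k" "v = Bound i" "lift k f v = Bound i"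
    with *[OF w] e ** show ?thesis by metis
  next
    fix v' assume v': "v' \<in> scope V n" "v = shift k v'" "lift k f v = shift k (f v')"
    with *[OF w] e ** obtain w' where
      w': "w' \<in> scope V n" "w = shift k w'" "lift k f w = shift k (f w')" by metis
    then have "f v' = f w'" using v' e by (simp add: inj_shift)
    with v' w' assms show ?thesis by (auto simp: inj_on_def)
  qed
qed

lemma var_ty_shift: "var_ty (Ts @ E) (shift (length Ts) v) = var_ty E v"
  by (cases v) auto

lemma lift_types:
  assumes "\<And>v. v \<in> scope V (length E) \<Longrightarrow> var_ty E' (f v) = var_ty E v"
    and "v \<in> scope V (length (Ts @ E))"
  shows "var_ty (Ts @ E') (lift (length Ts) f v) = var_ty (Ts @ E) v"
proof (cases v)
  case (Free m T)
  then have "v \<in> scope V (length E)"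
    using assms(2) by (auto simp: scope_def)
  with Free assms(1)[of v] show ?thesis by (simp add: var_ty_shift)
next
  case (Bound i)
  show ?thesis
  proof (cases "i < length Ts")
    case False
    then have "Bound (i - length Ts) \<in> scope V (length E)"
      using assms(2) Bound by (auto simp: scope_def frees_def)
    then show ?thesis
      using False Bound assms(1) by (auto simp: var_ty_shift nth_append)
  qed (use Bound in \<open>auto simp: nth_append\<close>)
qed

lemma vars_of_types_map:
  assumes "vars_of_types E ys Ts" "frees (set ys) \<subseteq> V"
    and "inj_on f (scope V (length E))"
    and "\<And>v. v \<in> scope V (length E) \<Longrightarrow> var_ty E' (f v) = var_ty E v"
  shows "vars_of_types E' (map f ys) Ts"
proof -
  have s: "set ys \<subseteq> scope V (length E)"
    using vars_in_scope[OF assms(1,2)] by auto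
  then have "map (var_ty E') (map f ys) = map (var_ty E) ys"
    using assms(4) by (simp add: subset_iff)
  moreover have "distinct (map f ys)"
    using assms(1,3) s by (auto simp: vars_of_types_def distinct_map intro: inj_on_subset)
  ultimately show ?thesis
    using assms(1) by (simp only: vars_of_types_def)
qed

text \<open>Injectivity enters because well-typedness demands distinct arguments of metavariables
  and recursion constants.\<close>

lemma wt_ren:
  assumes "wt sig E m M T" "fv M \<subseteq> V"
    and "inj_on f (scope V (length E))"
    and "\<And>v. v \<in> scope V (length E) \<Longrightarrow> var_ty E' (f v) = var_ty E v"
  shows "wt sig E' m (ren f M) T"
  using assms
proof (induction arbitrary: E' f rule: wt.induct)
  case (wt_App Ts E h Ss b Ns)
  let ?f = "lift (length Ts) f"
  have inj: "inj_on ?f (scope V (length (Ts @ E)))"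
    using inj_on_lift[OF wt_App.prems(2)] by simp
  have ty: "var_ty (Ts @ E') (?f v) = var_ty (Ts @ E) v" if "v \<in> scope V (length (Ts @ E))" for v
    by (rule lift_types[where V = V]) (use wt_App.prems(3) that in auto)
  have "head_ty sig (Ts @ E') (ren_head ?f h) = Some (Ty Ss b)"
  proof (cases h)
    case (HVar v)
    then have "v \<in> scope V (length (Ts @ E))"
      using wt_App.hyps(1) wt_App.prems(1) by (intro head_in_scope[of sig]) auto
    from ty[OF this] show ?thesis
      using HVar wt_App.hyps(1) by simp
  qed (use wt_App.hyps(1) in auto)
  moreover have "list_all2 (wt sig (Ts @ E') Recu) (map (ren ?f) Ns) Ss"
    unfolding list_all2_conv_all_nth
  proof (intro conjI allI impI)
    show "length (map (ren ?f) Ns) = length Ss"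
      using wt_App.IH by (auto simp: list_all2_lengthD)
    fix i assume i: "i < length (map (ren ?f) Ns)"
    then have "fv (Ns ! i) \<subseteq> V"
      using wt_App.prems(1) by (auto dest!: nth_mem)
    with i wt_App.IH inj ty show "wt sig (Ts @ E') Recu (map (ren ?f) Ns ! i) (Ss ! i)"
      by (auto simp: list_all2_conv_all_nth)
  qed
  ultimately show ?case
    by (auto intro: wt.wt_App)
next
  case (wt_Meta H Ss b Ts E ys)
  have inj: "inj_on (lift (length Ts) f) (scope V (length (Ts @ E)))"
    using inj_on_lift[OF wt_Meta.prems(2)] by simp
  have "vars_of_types (Ts @ E') (map (lift (length Ts) f) ys) Ss"
    using wt_Meta.prems(1)
    by (intro vars_of_types_map[OF wt_Meta.hyps(2) _ inj lift_types[where V = V]])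
      (use wt_Meta.prems(3) in auto)
  with wt_Meta.hyps show ?case by (auto intro: wt.wt_Meta)
next
  case (wt_Rec r Ss b Ts E ys)
  have inj: "inj_on (lift (length Ts) f) (scope V (length (Ts @ E)))"
    using inj_on_lift[OF wt_Rec.prems(2)] by simp
  have "vars_of_types (Ts @ E') (map (lift (length Ts) f) ys) Ss"
    using wt_Rec.prems(1)
    by (intro vars_of_types_map[OF wt_Rec.hyps(2) _ inj lift_types[where V = V]])
      (use wt_Rec.prems(3) in auto)
  with wt_Rec.hyps show ?case by (auto intro: wt.wt_Rec)
qed

text \<open>\<open>ren_rename\<close>, \<open>ren_instantiate\<close> and \<open>abstract\<close>
  rest on this: the functions compared there may differ outside the scope.\<close>

lemma ren_cong:
  assumes "wt sig E m M T" "fv M \<subseteq> V" "\<And>v. v \<in> scope V (length E) \<Longrightarrow> f v = g v"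
  shows "ren f M = ren g M"
  using assms
proof (induction arbitrary: f g rule: wt.induct)
  case (wt_App Ts E h Ss b Ns)
  note eq = lift_eq_on_scope[OF wt_App.prems(2), where k = "length Ts"]
  have "ren_head (lift (length Ts) f) h = ren_head (lift (length Ts) g) h"
  proof (cases h)
    case (HVar v)
    then have "v \<in> scope V (length (Ts @ E))"
      using wt_App.hyps(1) wt_App.prems(1) by (intro head_in_scope[of sig]) auto
    with HVar eq show ?thesis by simp
  qed auto
  moreover have "ren (lift (length Ts) f) N = ren (lift (length Ts) g) N" if "N \<in> set Ns" for N
  proof -
    from that obtain i where i: "i < length Ns" "N = Ns ! i" by (auto simp: in_set_conv_nth)
    moreover have "fv N \<subseteq> V" using that wt_App.prems(1) by auto
    ultimately show ?thesis
      using wt_App.IH eq by (auto simp: list_all2_conv_all_nth)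
  qed
  ultimately show ?case by simp
next
  case (wt_Meta H Ss b Ts E ys)
  have "lift (length Ts) f y = lift (length Ts) g y" if "y \<in> set ys" for y
    using lift_eq_on_scope[OF wt_Meta.prems(2)] vars_in_scope[OF wt_Meta.hyps(2) _ that]
      wt_Meta.prems(1) by auto
  then show ?case by simp
next
  case (wt_Rec r Ss b Ts E ys)
  have "lift (length Ts) f y = lift (length Ts) g y" if "y \<in> set ys" for y
    using lift_eq_on_scope[OF wt_Rec.prems(2)] vars_in_scope[OF wt_Rec.hyps(2) _ that]
      wt_Rec.prems(1) by auto
  then show ?case by simp
qed

lemma lift_frees:
  assumes "\<And>v. v \<in> scope V n \<Longrightarrow> f v \<in> W" "v \<in> scope V (k + n)" "lift k f v = Free a T"
  shows "Free a T \<in> W"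
proof -
  have *: "w = Free a T" if "shift k w = Free a T" for w
    using that by (cases w) auto
  show ?thesis
  proof (cases v)
    case (Free b S)
    with assms(2) have "v \<in> scope V n" by (auto simp: scope_def)
    with assms(1) Free assms(3) * show ?thesis by fastforce
  next
    case (Bound i)
    with assms(3) have i: "\<not> i < k" by auto
    with assms(2) Bound have "Bound (i - k) \<in> scope V n"
      by (auto simp: scope_def frees_def)
    with assms(1) Bound assms(3) * i show ?thesis by fastforce
  qed
qed

lemma fv_ren:
  assumes "wt sig E m M T" "fv M \<subseteq> V" "\<And>v. v \<in> scope V (length E) \<Longrightarrow> f v \<in> W"
  shows "fv (ren f M) \<subseteq> W"
proof -
  \<comment> \<open>Under a block of binders the renaming also produces indices, which need not lie
    in \<open>W\<close>. The induction enlarges \<open>W\<close> by all indices there, and the bound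
    \<open>frees W\<close> is not affected by that.\<close>
  have "fv (ren f M) \<subseteq> frees W"
    using assms
  proof (induction arbitrary: f W rule: wt.induct)
    case (wt_App Ts E h Ss b Ns)
    let ?W = "frees W \<union> range Bound"
    have eq: "lift (length Ts) f v \<in> ?W" if v: "v \<in> scope V (length (Ts @ E))" for v
    proof (cases "lift (length Ts) f v")
      case (Free a T)
      have "Free a T \<in> W"
        by (rule lift_frees[OF wt_App.prems(2), where v = v and k = "length Ts"])
          (use v Free in auto)
      with Free show ?thesis by (auto simp: frees_def)
    qed auto
    have frW: "frees ?W = frees W"
      by (auto simp: frees_def)
    have "fv_head (ren_head (lift (length Ts) f) h) \<subseteq> frees W"
    proof (cases h)
      case (HVar v)
      then have "v \<in> scope V (length (Ts @ E))"
        using wt_App.hyps(1) wt_App.prems(1) by (intro head_in_scope[of sig]) auto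
      from eq[OF this] HVar show ?thesis by (auto simp: frees_def)
    qed auto
    moreover have "fv (ren (lift (length Ts) f) N) \<subseteq> frees W" if "N \<in> set Ns" for N
    proof -
      from that obtain i where i: "i < length Ns" "N = Ns ! i" by (auto simp: in_set_conv_nth)
      moreover have V: "fv N \<subseteq> V" using that wt_App.prems(1) by auto
      ultimately have "\<forall>f W. fv N \<subseteq> V \<longrightarrow> (\<forall>v. v \<in> scope V (length (Ts @ E)) \<longrightarrow> f v \<in> W)
          \<longrightarrow> fv (ren f N) \<subseteq> frees W"
        using wt_App.IH by (auto simp: list_all2_conv_all_nth)
      then have "fv (ren (lift (length Ts) f) N) \<subseteq> frees ?W"
        using V eq by blast
      then show ?thesis by (simp add: frW)
    qed
    ultimately show ?case by auto
  next
    case (wt_Meta H Ss b Ts E ys)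
    show ?case
    proof
      fix v assume "v \<in> fv (ren f (Meta Ts H ys))"
      then obtain y a T where y: "y \<in> set ys" "lift (length Ts) f y = v" "v = Free a T"
        by (auto simp: frees_def)
      have "y \<in> scope V (length (Ts @ E))"
        using wt_Meta.prems(1) by (intro vars_in_scope[OF wt_Meta.hyps(2) _ y(1)]) auto
      then have "Free a T \<in> W"
        by (intro lift_frees[OF wt_Meta.prems(2), where v = y and k = "length Ts"]) (use y in auto)
      with y show "v \<in> frees W" by (auto simp: frees_def)
    qed
  next
    case (wt_Rec r Ss b Ts E ys)
    show ?case
    proof
      fix v assume "v \<in> fv (ren f (Rec Ts r ys))"
      then obtain y a T where y: "y \<in> set ys" "lift (length Ts) f y = v" "v = Free a T"
        by (auto simp: frees_def)
      have "y \<in> scope V (length (Ts @ E))"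
        using wt_Rec.prems(1) by (intro vars_in_scope[OF wt_Rec.hyps(2) _ y(1)]) auto
      then have "Free a T \<in> W"
        by (intro lift_frees[OF wt_Rec.prems(2), where v = y and k = "length Ts"]) (use y in auto)
      with y show "v \<in> frees W" by (auto simp: frees_def)
    qed
  qed
  with freesD show ?thesis by blast
qed

section \<open>Binder blocks and lists of typed variables\<close>

lemma wt_binders: "wt sig E m M (Ty Ts b) \<Longrightarrow> binders M = Ts"
  by (auto elim: wt.cases)

lemma wt_Ty: "wt sig E m M T \<Longrightarrow> \<exists>b. T = Ty (binders M) b"
  by (auto elim: wt.cases)

lemma wt_drop_binders:
  "wt sig E m M (Ty Ts b) \<Longrightarrow> wt sig (Ts @ E) m (set_binders [] M) (Ty [] b)"
  by (auto elim!: wt.cases[of _ E] intro!: wt.intros)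

lemma wt_set_binders:
  "wt sig (Ts @ E) m M (Ty [] b) \<Longrightarrow> wt sig E m (set_binders Ts M) (Ty Ts b)"
  by (auto elim!: wt.cases[of _ "Ts @ E"] intro!: wt.intros)

lemma vars_of_types_length: "vars_of_types E ys Ts \<Longrightarrow> length ys = length Ts"
  unfolding vars_of_types_def by (metis length_map)

lemma vars_of_types_distinct: "vars_of_types E ys Ts \<Longrightarrow> distinct ys"
  by (simp add: vars_of_types_def)

lemma vars_of_types_nth:
  "vars_of_types E ys Ts \<Longrightarrow> i < length Ts \<Longrightarrow> var_ty E (ys ! i) = Some (Ts ! i)"
  unfolding vars_of_types_def by (metis length_map nth_map)

lemma vars_of_types_Free: "vars_of_types [] ys Ts \<Longrightarrow> v \<in> set ys \<Longrightarrow> \<exists>n T. v = Free n T"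
  using vars_in_scope[of "[]" ys Ts UNIV v] by (auto simp: scope_def frees_def)

lemma frees_vars: "vars_of_types [] ys Ts \<Longrightarrow> frees (set ys) = set ys"
  using vars_of_types_Free by (fastforce simp: frees_def)

section \<open>Simultaneous renaming of variables and opening of binders\<close>

definition renaming :: "'b var list \<Rightarrow> 'b var list \<Rightarrow> 'b var \<Rightarrow> 'b var" where
  "renaming ys xs v = (case map_of (zip xs ys) v of Some w \<Rightarrow> w | None \<Rightarrow> v)"

lemma rename_eq: "rename ys xs M = ren (renaming ys xs) M"
  by (simp add: rename_def renaming_def[abs_def])

lemma renaming_nth:
  "distinct xs \<Longrightarrow> length ys = length xs \<Longrightarrow> i < length xs \<Longrightarrow> renaming ys xs (xs ! i) = ys ! i"
  by (simp add: renaming_def map_of_zip_nth)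

lemma map_renaming: "distinct xs \<Longrightarrow> length ys = length xs \<Longrightarrow> map (renaming ys xs) xs = ys"
  by (rule nth_equalityI) (auto simp: renaming_nth)

lemma renaming_in: "distinct xs \<Longrightarrow> length ys = length xs \<Longrightarrow> v \<in> set xs \<Longrightarrow> renaming ys xs v \<in> set ys"
  by (auto simp: in_set_conv_nth renaming_nth)

lemma renaming_map:
  "distinct xs \<Longrightarrow> length ys = length xs \<Longrightarrow> v \<in> set xs \<Longrightarrow>
    renaming (map f ys) xs v = f (renaming ys xs v)"
  by (auto simp: in_set_conv_nth renaming_nth)

text \<open>All variables of \<open>R\<close> are among \<open>xs\<close>, so after the renaming
  \<open>f\<close> meets only variables from \<open>ys\<close>.\<close>

lemma ren_rename:
  assumes "wt sig [] m R T" "fv R \<subseteq> set xs" "distinct xs" "length ys = length xs"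
  shows "ren f (rename ys xs R) = rename (map f ys) xs R"
  unfolding rename_eq ren_ren
  using assms(3,4)
  by (intro ren_cong[OF assms(1,2)]) (auto simp: scope_def renaming_map dest: freesD)

lemma wt_rename:
  assumes "wt sig [] m R T" "fv R \<subseteq> set xs" "vars_of_types [] xs Ss" "vars_of_types E ys Ss"
  shows "wt sig E m (rename ys xs R) T"
proof -
  have x: "distinct xs" "length xs = length Ss" "length ys = length xs" "distinct ys"
    using assms vars_of_types_length vars_of_types_distinct by metis+
  have "scope (set xs) (length []) = set xs"
    using frees_vars[OF assms(3)] by (simp add: scope_def)
  moreover have "inj_on (renaming ys xs) (set xs)"
    using x by (auto simp: inj_on_def in_set_conv_nth renaming_nth nth_eq_iff_index_eq)
  moreover have "var_ty E (renaming ys xs v) = var_ty [] v" if "v \<in> set xs" for v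
    using that x vars_of_types_nth[OF assms(3)] vars_of_types_nth[OF assms(4)]
    by (auto simp: in_set_conv_nth renaming_nth)
  ultimately show ?thesis
    unfolding rename_eq by (intro wt_ren[OF assms(1,2)]) auto
qed

lemma fv_rename:
  assumes "wt sig [] m R T" "fv R \<subseteq> set xs" "distinct xs" "length ys = length xs"
  shows "fv (rename ys xs R) \<subseteq> set ys"
  unfolding rename_eq
  using assms(3,4)
  by (intro fv_ren[OF assms(1,2)]) (auto simp: scope_def renaming_in dest: freesD)

definition inst_var :: "'b var list \<Rightarrow> 'b var \<Rightarrow> 'b var" where
  "inst_var ys v = (case v of Free k T \<Rightarrow> Free k T
     | Bound i \<Rightarrow> if i < length ys then ys ! i else Bound (i - length ys))"

lemma instantiate_eq: "instantiate M ys = ren (inst_var ys) (set_binders [] M)"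
  by (simp add: instantiate_def inst_var_def[abs_def])

lemma binders_instantiate [simp]: "binders (instantiate M ys) = []"
  by (simp add: instantiate_eq)

lemma wt_instantiate:
  assumes "wt sig [] m U (Ty Ss b)" "fv U = {}" "vars_of_types E ys Ss"
  shows "wt sig E m (instantiate U ys) (Ty [] b)"
proof -
  have y: "length ys = length Ss" "distinct ys"
    using assms(3) vars_of_types_length vars_of_types_distinct by metis+
  have "wt sig Ss m (set_binders [] U) (Ty [] b)"
    using wt_drop_binders[OF assms(1)] by simp
  then show ?thesis
    unfolding instantiate_eq
    by (rule wt_ren[where V = "{}"])
      (use y vars_of_types_nth[OF assms(3)] assms(2) in
        \<open>auto simp: scope_def frees_def inj_on_def inst_var_def nth_eq_iff_index_eq\<close>)
qed

lemma ren_instantiate: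
  assumes "wt sig [] m U (Ty Ss b)" "fv U = {}" "length ys = length Ss"
  shows "ren f (instantiate U ys) = instantiate U (map f ys)"
proof -
  have "wt sig Ss m (set_binders [] U) (Ty [] b)"
    using wt_drop_binders[OF assms(1)] by simp
  then show ?thesis
    unfolding instantiate_eq ren_ren
    by (rule ren_cong[where V = "{}"])
      (use assms(2,3) in \<open>auto simp: scope_def frees_def inst_var_def\<close>)
qed


subsection \<open>Replacing metavariables\<close>

type_synonym ('b, 'c) bodies = "'b mvar \<Rightarrow> ('b var list \<times> ('b, 'c) trm) option"

text \<open>The common invariant of all maps passed to \<open>replace\<close>: the substitutions,
  the choice \<rho>, its iterates, and their copies with renamed recursion constants. Each entry
  amounts to a closed term \<lambda>\<open>zs\<close>. \<open>R\<close> of the type of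
  \<open>H\<close>.\<close>

definition wf_bodies :: "('c \<Rightarrow> 'b ty) \<Rightarrow> ('b, 'c) bodies \<Rightarrow> bool" where
  "wf_bodies sig \<sigma> \<longleftrightarrow> (\<forall>H zs R. \<sigma> H = Some (zs, R) \<longrightarrow>
     vars_of_types [] zs (doms (mty H)) \<and> wt sig [] (mtag H) R (Ty [] (cod (mty H))) \<and>
     fv R \<subseteq> set zs)"

lemma wf_bodiesD:
  assumes "wf_bodies sig \<sigma>" "\<sigma> H = Some (zs, R)"
  shows "vars_of_types [] zs (doms (mty H))" "wt sig [] (mtag H) R (Ty [] (cod (mty H)))"
    "fv R \<subseteq> set zs" "distinct zs" "length zs = length (doms (mty H))" "binders R = []"
  using assms vars_of_types_length vars_of_types_distinct wt_binders
  unfolding wf_bodies_def by metis+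

lemma replace_set_binders: "replace \<sigma> (set_binders Ts M) = set_binders Ts (replace \<sigma> M)"
  by (cases M) (auto split: option.splits)

lemma wt_MetaD:
  assumes "wt sig E m (Meta Ts H ys) T"
  shows "m = mtag H" "T = Ty Ts (cod (mty H))" "vars_of_types (Ts @ E) ys (doms (mty H))"
    "length ys = length (doms (mty H))" "distinct ys"
proof -
  have *: "m = mtag H \<and> T = Ty Ts (cod (mty H)) \<and> vars_of_types (Ts @ E) ys (doms (mty H))"
    using assms by (auto elim: wt.cases)
  then show "m = mtag H" "T = Ty Ts (cod (mty H))" "vars_of_types (Ts @ E) ys (doms (mty H))"
    by auto
  with * show "length ys = length (doms (mty H))" "distinct ys"
    using vars_of_types_length vars_of_types_distinct by metis+
qed

lemma wt_RecD:
  assumes "wt sig E m (Rec Ts r ys) T"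
  shows "m = Recu" "T = Ty Ts (cod (rty r))" "vars_of_types (Ts @ E) ys (doms (rty r))"
    "length ys = length (doms (rty r))"
proof -
  have *: "m = Recu \<and> T = Ty Ts (cod (rty r)) \<and> vars_of_types (Ts @ E) ys (doms (rty r))"
    using assms by (auto elim: wt.cases)
  then show "m = Recu" "T = Ty Ts (cod (rty r))" "vars_of_types (Ts @ E) ys (doms (rty r))"
    by auto
  with * show "length ys = length (doms (rty r))"
    using vars_of_types_length by metis
qed

lemma wt_AppD:
  assumes "wt sig E m (App Ts h Ns) T"
  shows "m = Con" "\<exists>Ss b. head_ty sig (Ts @ E) h = Some (Ty Ss b) \<and> T = Ty Ts b \<and>
    list_all2 (wt sig (Ts @ E) Recu) Ns Ss"
  using assms by (auto elim: wt.cases)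

lemma wt_arg:
  assumes "wt sig E m (App Ts h Ns) T" "N \<in> set Ns"
  shows "\<exists>S. wt sig (Ts @ E) Recu N S"
  using wt_AppD(2)[OF assms(1)] assms(2) by (auto simp: list_all2_conv_all_nth in_set_conv_nth)

lemma wt_MetaI:
  assumes "vars_of_types (Ts @ E) ys (doms (mty H))"
  shows "wt sig E (mtag H) (Meta Ts H ys) (Ty Ts (cod (mty H)))"
  using assms by (intro wt.wt_Meta) auto

text \<open>A body has no variables besides its parameters, so a renaming acts on a replaced
  metavariable only through its arguments (\<open>ren_rename\<close>).\<close>

lemma replace_ren:
  assumes "wf_bodies sig \<sigma>" "wt sig E m M T"
  shows "replace \<sigma> (ren f M) = ren f (replace \<sigma> M)"
  using assms(2)
proof (induction M arbitrary: E m T f)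
  case (App Ts h Ns)
  have "replace \<sigma> (ren (lift (length Ts) f) N) = ren (lift (length Ts) f) (replace \<sigma> N)"
    if "N \<in> set Ns" for N
    using App.IH[OF that] wt_arg[OF App.prems that] by blast
  then show ?case by simp
next
  case (Meta Ts H ys)
  show ?case
  proof (cases "\<sigma> H")
    case (Some p)
    obtain zs R where p: "p = (zs, R)" by (cases p)
    note b = wf_bodiesD[OF assms(1) Some[unfolded p]]
    have "set_binders [] (rename ys zs R) = rename ys zs R"
      using b(6) set_binders_binders[of "rename ys zs R"] by (simp add: rename_eq)
    then have "ren f (set_binders Ts (rename ys zs R))
        = set_binders Ts (ren (lift (length Ts) f) (rename ys zs R))"
      by (simp add: ren_set_binders[of f Ts])
    then show ?thesis
      using Some p b wt_MetaD[OF Meta] ren_rename[OF b(2,3,4)] by simp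
  qed simp
qed simp

lemma replace_rename:
  assumes "wf_bodies sig \<sigma>" "wt sig E m M T"
  shows "replace \<sigma> (rename ys xs M) = rename ys xs (replace \<sigma> M)"
  using replace_ren[OF assms] by (simp add: rename_eq)

lemma replace_instantiate:
  assumes "wf_bodies sig \<sigma>" "wt sig E m M T"
  shows "replace \<sigma> (instantiate M ys) = instantiate (replace \<sigma> M) ys"
proof -
  from wt_Ty[OF assms(2)] obtain b where "T = Ty (binders M) b" by blast
  with assms(2) have "wt sig (binders M @ E) m (set_binders [] M) (Ty [] b)"
    using wt_drop_binders[of sig E m M "binders M" b] by simp
  from replace_ren[OF assms(1) this] show ?thesis
    by (simp add: instantiate_eq replace_set_binders)
qed

lemma wt_replace:
  assumes "wf_bodies sig \<sigma>" "wt sig E m M T"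
  shows "wt sig E m (replace \<sigma> M) T"
  using assms(2)
proof (induction M arbitrary: E m T)
  case (App Ts h Ns)
  from wt_AppD[OF App.prems] obtain Ss b where
    a: "head_ty sig (Ts @ E) h = Some (Ty Ss b)" "T = Ty Ts b" "m = Con"
      "list_all2 (wt sig (Ts @ E) Recu) Ns Ss" by blast
  have "list_all2 (wt sig (Ts @ E) Recu) (map (replace \<sigma>) Ns) Ss"
    using a(4) App.IH by (auto simp: list_all2_conv_all_nth)
  with a show ?case by (auto intro: wt.wt_App)
next
  case (Meta Ts H ys)
  note m = wt_MetaD[OF Meta]
  show ?case
  proof (cases "\<sigma> H")
    case (Some p)
    obtain zs R where p: "p = (zs, R)" by (cases p)
    note b = wf_bodiesD[OF assms(1) Some[unfolded p]]
    show ?thesis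
      using Some p m wt_set_binders[OF wt_rename[OF b(2,3,1) m(3)]] by simp
  qed (use Meta in simp)
qed simp

lemma fv_replace:
  assumes "wf_bodies sig \<sigma>" "wt sig E m M T"
  shows "fv (replace \<sigma> M) \<subseteq> fv M"
  using assms(2)
proof (induction M arbitrary: E m T)
  case (App Ts h Ns)
  have "fv (replace \<sigma> N) \<subseteq> fv N" if "N \<in> set Ns" for N
    using App.IH[OF that] wt_arg[OF App.prems that] by blast
  then show ?case by auto
next
  case (Meta Ts H ys)
  note m = wt_MetaD[OF Meta]
  show ?case
  proof (cases "\<sigma> H")
    case (Some p)
    obtain zs R where p: "p = (zs, R)" by (cases p)
    note b = wf_bodiesD[OF assms(1) Some[unfolded p]]
    have "fv (rename ys zs R) \<subseteq> set ys"
      using fv_rename[OF b(2,3,4)] b m by simp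
    then have "fv (rename ys zs R) \<subseteq> frees (set ys)"
      using fv_Free[of _ "rename ys zs R"] by (auto simp: frees_def)
    then show ?thesis using Some p by simp
  qed simp
qed simp

lemma mvs_replace:
  "mvs (replace \<sigma> M) = (\<Union>H\<in>mvs M. case \<sigma> H of Some (zs, R) \<Rightarrow> mvs R | None \<Rightarrow> {H})"
proof (induction M)
  case (Meta Ts H ys)
  then show ?case by (auto simp: rename_eq split: option.splits)
qed auto

lemma rcs_replace:
  assumes "\<And>H zs R. \<sigma> H = Some (zs, R) \<Longrightarrow> rcs R \<subseteq> S"
  shows "rcs (replace \<sigma> M) \<subseteq> rcs M \<union> S"
proof (induction M)
  case (Meta Ts H ys)
  show ?case
    using assms by (auto simp: rename_eq split: option.splits)
qed auto

text \<open>With \<open>replace \<tau>\<close> this gives composition of replacements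
  (\<open>replace_map_bodies\<close>), with \<open>map_rcs\<close> renaming apart
  (\<open>lookup_rename_apart\<close>), and with an iterate of \<open>replace \<rho>\<close> the
  substitution \<gamma>.\<close>

definition map_bodies :: "(('b, 'c) trm \<Rightarrow> ('b, 'c) trm) \<Rightarrow> ('b, 'c) bodies \<Rightarrow> ('b, 'c) bodies" where
  "map_bodies f \<sigma> H = map_option (\<lambda>(zs, R). (zs, f R)) (\<sigma> H)"

lemma map_bodies_Some:
  "map_bodies f \<sigma> H = Some (zs, R) \<longleftrightarrow> (\<exists>R'. \<sigma> H = Some (zs, R') \<and> R = f R')"
  by (auto simp: map_bodies_def)

lemma wf_map_bodies:
  assumes "wf_bodies sig \<sigma>" "wf_bodies sig \<tau>"
  shows "wf_bodies sig (map_bodies (replace \<tau>) \<sigma>)"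
  unfolding wf_bodies_def map_bodies_Some
proof (intro allI impI, elim exE conjE)
  fix H zs R R'
  assume "\<sigma> H = Some (zs, R')" and R: "R = replace \<tau> R'"
  note b = wf_bodiesD[OF assms(1) this(1)]
  show "vars_of_types [] zs (doms (mty H)) \<and> wt sig [] (mtag H) R (Ty [] (cod (mty H))) \<and>
      fv R \<subseteq> set zs"
    using R b(1,3) wt_replace[OF assms(2) b(2)] fv_replace[OF assms(2) b(2)] by auto
qed

text \<open>\<open>map_bodies\<close> does not enlarge the domain of \<sigma>; hence the condition
  that \<tau> leaves alone every metavariable of \<open>M\<close> that \<sigma> leaves
  alone.\<close>

lemma replace_map_bodies:
  assumes "wf_bodies sig \<sigma>" "wf_bodies sig \<tau>" "wt sig E m M T"
    and "\<And>H. H \<in> mvs M \<Longrightarrow> \<sigma> H = None \<Longrightarrow> \<tau> H = None"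
  shows "replace (map_bodies (replace \<tau>) \<sigma>) M = replace \<tau> (replace \<sigma> M)"
  using assms(3,4)
proof (induction M arbitrary: E m T)
  case (App Ts h Ns)
  have "replace (map_bodies (replace \<tau>) \<sigma>) N = replace \<tau> (replace \<sigma> N)" if "N \<in> set Ns" for N
  proof -
    from wt_arg[OF App.prems(1) that] obtain S where "wt sig (Ts @ E) Recu N S" by blast
    from App.IH[OF that this] App.prems(2) that show ?thesis by auto
  qed
  then show ?case by simp
next
  case (Meta Ts H ys)
  show ?case
  proof (cases "\<sigma> H")
    case (Some p)
    obtain zs R where p: "p = (zs, R)" by (cases p)
    show ?thesis
      using Some p replace_rename[OF assms(2) wf_bodiesD(2)[OF assms(1) Some[unfolded p]]]
      by (simp add: map_bodies_def replace_set_binders)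
  qed (use Meta in \<open>simp add: map_bodies_def\<close>)
qed simp


subsection \<open>Expansion\<close>

fun eset_binders :: "'b ty list \<Rightarrow> ('b, 'c) etrm \<Rightarrow> ('b, 'c) etrm" where
  "eset_binders Ts EBot = EBot"
| "eset_binders Ts (EApp _ h Ns) = EApp Ts h Ns"
| "eset_binders Ts (EMeta _ H ys) = EMeta Ts H ys"

text \<open>Introduced so that the expansion of a renamed term is a function of the expansion of the
  term (\<open>expand_ren\<close>). Equality of expansions at a given depth is then preserved by
  renaming.\<close>

fun eren :: "('b var \<Rightarrow> 'b var) \<Rightarrow> ('b, 'c) etrm \<Rightarrow> ('b, 'c) etrm" where
  "eren f EBot = EBot"
| "eren f (EApp Ts h Ns) =
     EApp Ts (ren_head (lift (length Ts) f) h) (map (eren (lift (length Ts) f)) Ns)"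
| "eren f (EMeta Ts H ys) = EMeta Ts H (map (lift (length Ts) f) ys)"

text \<open>\<open>expand\<close> looks only at the definitions of a context. This is the fragment
  of \<open>wf_ctx\<close> that is established for \<open>subst_ctx\<close> and
  \<open>compose\<close>.\<close>

definition wf_defs :: "('c \<Rightarrow> 'b ty) \<Rightarrow> ('b rconst \<Rightarrow> ('b, 'c) trm option) \<Rightarrow> bool" where
  "wf_defs sig D \<longleftrightarrow> (\<forall>r U. D r = Some U \<longrightarrow> wt sig [] Con U (rty r) \<and> fv U = {})"

lemma unfold_set_binders: "unfold D (set_binders Ts M) = set_binders Ts (unfold D M)"
  by (cases M) (auto split: option.splits)

lemma expand_set_binders:
  "expand \<Delta> k (set_binders Ts M) = eset_binders Ts (expand \<Delta> k M)"
proof (cases k)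
  case (Suc j)
  then show ?thesis
    by (cases "unfold (defs \<Delta>) M") (simp_all add: unfold_set_binders)
qed simp

lemma wf_defsD:
  assumes "wf_defs sig D" "D r = Some U"
  shows "wt sig [] Con U (Ty (doms (rty r)) (cod (rty r)))" "fv U = {}"
  using assms unfolding wf_defs_def by auto

lemma wt_unfold_Rec:
  assumes "wf_defs sig D" "wt sig E m (Rec Ts r ys) T" "D r = Some U"
  shows "wt sig E Con (set_binders Ts (instantiate U ys)) T"
  using wt_set_binders[OF wt_instantiate[OF wf_defsD[OF assms(1,3)] wt_RecD(3)[OF assms(2)]]]
    wt_RecD(2)[OF assms(2)] by simp

lemma wt_unfold:
  assumes "wf_defs sig D" "wt sig E m M T"
  shows "\<exists>m. wt sig E m (unfold D M) T"
proof (cases M)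
  case (Rec Ts r ys)
  show ?thesis
  proof (cases "D r")
    case (Some U)
    with wt_unfold_Rec[OF assms(1) assms(2)[unfolded Rec]] Rec show ?thesis by auto
  qed (use assms Rec in auto)
qed (use assms in auto)

lemma unfold_ren:
  assumes "wf_defs sig D" "wt sig E m M T"
  shows "unfold D (ren f M) = ren f (unfold D M)"
proof (cases M)
  case (Rec Ts r ys)
  show ?thesis
  proof (cases "D r")
    case (Some U)
    have "set_binders [] (instantiate U ys) = instantiate U ys"
      using set_binders_binders[of "instantiate U ys"] by simp
    then show ?thesis
      using Some Rec ren_instantiate[OF wf_defsD[OF assms(1) Some]]
        wt_RecD(4)[OF assms(2)[unfolded Rec]]
      by (simp add: ren_set_binders[of f Ts])
  qed (use Rec in auto)
qed auto

lemma expand_ren: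
  assumes "wf_defs sig (defs \<Delta>)" "wt sig E m M T"
  shows "expand \<Delta> k (ren f M) = eren f (expand \<Delta> k M)"
  using assms(2)
proof (induction k arbitrary: E m M T f)
  case (Suc k)
  from wt_unfold[OF assms(1) Suc.prems] obtain m' where w: "wt sig E m' (unfold (defs \<Delta>) M) T"
    by blast
  show ?case
  proof (cases "unfold (defs \<Delta>) M")
    case (App Ts h Ns)
    have "expand \<Delta> k (ren f' N) = eren f' (expand \<Delta> k N)" if "N \<in> set Ns" for f' N
      using Suc.IH wt_arg[OF w[unfolded App] that] by blast
    with App show ?thesis by (simp add: unfold_ren[OF assms(1) Suc.prems])
  qed (simp_all add: unfold_ren[OF assms(1) Suc.prems])
qed simp

lemma expand_instantiate:
  assumes "wf_defs sig (defs \<Delta>)" "wt sig E m M T"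
  shows "expand \<Delta> k (instantiate M ys) = eren (inst_var ys) (eset_binders [] (expand \<Delta> k M))"
proof -
  from wt_Ty[OF assms(2)] obtain b where "T = Ty (binders M) b" by blast
  with assms(2) have "wt sig (binders M @ E) m (set_binders [] M) (Ty [] b)"
    using wt_drop_binders[of sig E m M "binders M" b] by simp
  from expand_ren[OF assms(1) this] show ?thesis
    by (simp add: instantiate_eq expand_set_binders)
qed

text \<open>Unfolding costs no depth: the instantiated body is contractive, so a second
  \<open>unfold\<close> leaves it as it is.\<close>

lemma expand_Rec:
  assumes "wf_defs sig (defs \<Delta>)" "wt sig E m (Rec Ts r ys) T" "defs \<Delta> r = Some U"
  shows "expand \<Delta> k (Rec Ts r ys) = expand \<Delta> k (set_binders Ts (instantiate U ys))"
proof -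
  have "wt sig E Con (set_binders Ts (instantiate U ys)) T"
    by (rule wt_unfold_Rec[OF assms])
  then have "unfold (defs \<Delta>) (set_binders Ts (instantiate U ys)) = set_binders Ts (instantiate U ys)"
    by (auto elim: wt.cases)
  then show ?thesis using assms(3) by (cases k) simp_all
qed

text \<open>Every occurrence \<open>H ys\<close> is a renaming of \<open>H zs\<close>, and expansion
  commutes with renaming, so the equation assumed for \<open>H zs\<close> transfers to it. This is
  how a unifier \<tau> absorbs the chosen equations \<sigma>.\<close>

lemma expand_replace_cong:
  fixes sig :: "'c \<Rightarrow> 'b ty"
  assumes D: "wf_defs sig (defs \<Delta>)" and s: "wf_bodies sig \<sigma>" and t: "wf_bodies sig \<tau>"
    and eq: "\<And>H zs R. \<sigma> H = Some (zs, R) \<Longrightarrow>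
      holds_in \<Delta> (replace \<tau> (Meta [] H zs)) (replace \<tau> R)"
    and "wt sig E m M T"
  shows "expand \<Delta> k (replace \<tau> (replace \<sigma> M)) = expand \<Delta> k (replace \<tau> M)"
  using assms(5)
proof (induction M arbitrary: E m T k)
  case (App Ts h Ns)
  have "expand \<Delta> j (replace \<tau> (replace \<sigma> N)) = expand \<Delta> j (replace \<tau> N)" if "N \<in> set Ns" for j N
    using App.IH[OF that] wt_arg[OF App.prems that] by blast
  then show ?case by (cases k) simp_all
next
  case (Meta Ts H ys)
  show ?case
  proof (cases "\<sigma> H")
    case (Some p)
    obtain zs R where p: "p = (zs, R)" by (cases p)
    note b = wf_bodiesD[OF s Some[unfolded p]]
    let ?f = "renaming ys zs" and ?H = "Meta [] H zs :: ('b, 'c) trm"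
    have wH: "wt sig [] (mtag H) ?H (Ty [] (cod (mty H)))"
      using b(1) by (intro wt_MetaI) simp
    have "replace \<tau> (replace \<sigma> (Meta Ts H ys)) = set_binders Ts (ren ?f (replace \<tau> R))"
      using Some p replace_ren[OF t b(2)] by (simp add: replace_set_binders rename_eq)
    moreover have "replace \<tau> (Meta Ts H ys) = set_binders Ts (ren ?f (replace \<tau> ?H))"
    proof -
      have "Meta Ts H ys = set_binders Ts (ren ?f ?H)"
        using map_renaming[of zs ys] b wt_MetaD[OF Meta] by (simp add: lift_0)
      then show ?thesis
        by (simp only: replace_set_binders replace_ren[OF t wH])
    qed
    moreover have "expand \<Delta> k (ren ?f (replace \<tau> R)) = expand \<Delta> k (ren ?f (replace \<tau> ?H))"
      using eq[OF Some[unfolded p]] expand_ren[OF D wt_replace[OF t b(2)]]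
        expand_ren[OF D wt_replace[OF t wH]] by (simp add: holds_in_def)
    ultimately show ?thesis by (simp add: expand_set_binders)
  qed simp
qed simp

text \<open>One body is exchanged for the other inside \<open>\<Delta>1\<close>, where their
  expansions are equal. The new body is contractive, so the two contexts are then compared only on
  its arguments, at a smaller depth.\<close>

lemma expand_defs_cong:
  assumes D1: "wf_defs sig (defs \<Delta>1)" and D2: "wf_defs sig (defs \<Delta>2)"
    and dom: "dom (defs \<Delta>1) = dom (defs \<Delta>2)"
    and eq: "\<And>r U1 U2. defs \<Delta>1 r = Some U1 \<Longrightarrow> defs \<Delta>2 r = Some U2 \<Longrightarrow> holds_in \<Delta>1 U1 U2"
    and "wt sig E m M T"
  shows "expand \<Delta>1 k M = expand \<Delta>2 k M"
  using assms(5)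
proof (induction k arbitrary: E m M T)
  case (Suc k)
  have nonrec: "expand \<Delta>1 (Suc k) X = expand \<Delta>2 (Suc k) X" if X: "wt sig E Con X T" for X
  proof (cases X)
    case (App Ts h Ns)
    have "expand \<Delta>1 k N = expand \<Delta>2 k N" if "N \<in> set Ns" for N
      using Suc.IH wt_arg[OF X[unfolded App] that] by blast
    with App show ?thesis by simp
  next
    case (Rec Ts r ys)
    with wt_RecD(1) X show ?thesis by blast
  qed simp
  show ?case
  proof (cases M)
    case (Rec Ts r ys)
    note w = Suc.prems[unfolded Rec]
    show ?thesis
    proof (cases "defs \<Delta>1 r")
      case None
      with dom have "defs \<Delta>2 r = None" by (metis domIff)
      with None Rec show ?thesis by simp
    next
      case (Some U1)
      with dom obtain U2 where U2: "defs \<Delta>2 r = Some U2" by (metis domD domI)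
      note u1 = wf_defsD[OF D1 Some] and u2 = wf_defsD[OF D2 U2]
      have "expand \<Delta>1 (Suc k) M = expand \<Delta>1 (Suc k) (set_binders Ts (instantiate U1 ys))"
        by (simp only: Rec expand_Rec[OF D1 w Some])
      also have "\<dots> = expand \<Delta>1 (Suc k) (set_binders Ts (instantiate U2 ys))"
        using eq[OF Some U2]
        by (simp only: expand_set_binders expand_instantiate[OF D1 u1(1)]
            expand_instantiate[OF D1 u2(1)] holds_in_def)
      also have "\<dots> = expand \<Delta>2 (Suc k) (set_binders Ts (instantiate U2 ys))"
        by (rule nonrec[OF wt_unfold_Rec[OF D2 w U2]])
      also have "\<dots> = expand \<Delta>2 (Suc k) M"
        by (simp only: Rec expand_Rec[OF D2 w U2])
      finally show ?thesis .
    qed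
  next
    case (App Ts h Ns)
    with Suc.prems wt_AppD(1) nonrec show ?thesis by blast
  qed simp
qed simp


subsection \<open>Renaming recursion constants\<close>

lemma map_rcs_set_binders: "map_rcs g (set_binders Ts M) = set_binders Ts (map_rcs g M)"
  by (cases M) auto

lemma map_rcs_ren: "map_rcs g (ren f M) = ren f (map_rcs g M)"
  by (induction M arbitrary: f) auto

lemma map_rcs_instantiate: "map_rcs g (instantiate M ys) = instantiate (map_rcs g M) ys"
  by (simp add: instantiate_eq map_rcs_ren map_rcs_set_binders)

lemma map_rcs_replace:
  "map_rcs g (replace \<sigma> M) = replace (map_bodies (map_rcs g) \<sigma>) (map_rcs g M)"
proof (induction M)
  case (Meta Ts H ys)
  show ?case
    by (auto simp: map_bodies_def rename_eq map_rcs_ren map_rcs_set_binders split: option.splits)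
qed auto

lemma map_rcs_map_rcs: "map_rcs g (map_rcs f M) = map_rcs (g \<circ> f) M"
  by (induction M) auto

lemma map_rcs_id: "(\<And>r. r \<in> rcs M \<Longrightarrow> g r = r) \<Longrightarrow> map_rcs g M = M"
  by (induction M) (auto intro!: map_idI)

lemma rcs_map_rcs [simp]: "rcs (map_rcs g M) = g ` rcs M"
  by (induction M) auto

lemma fv_map_rcs [simp]: "fv (map_rcs g M) = fv M"
  by (induction M) auto

lemma wt_map_rcs:
  assumes "\<And>r. rty (g r) = rty r" "wt sig E m M T"
  shows "wt sig E m (map_rcs g M) T"
  using assms(2)
proof (induction M arbitrary: E m T)
  case (App Ts h Ns)
  from wt_AppD[OF App.prems] obtain Ss b where
    a: "head_ty sig (Ts @ E) h = Some (Ty Ss b)" "T = Ty Ts b" "m = Con"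
      "list_all2 (wt sig (Ts @ E) Recu) Ns Ss" by blast
  have "list_all2 (wt sig (Ts @ E) Recu) (map (map_rcs g) Ns) Ss"
    using a(4) App.IH by (auto simp: list_all2_conv_all_nth)
  with a show ?case by (auto intro: wt.wt_App)
next
  case (Rec Ts r ys)
  from wt_RecD[OF this] assms(1) show ?case by (auto intro!: wt.wt_Rec)
qed simp

text \<open>\<open>S\<close> is a set of constants closed under unfolding. The map \<open>g\<close>
  may identify constants, which is what \<open>expand_subst_ctx_lower\<close> does with
  \<open>lower\<close>.\<close>

lemma expand_map_rcs:
  assumes closed: "\<And>r. r \<in> S \<Longrightarrow> \<exists>U. defs \<Delta>1 r = Some U \<and> defs \<Delta>2 (g r) = Some (map_rcs g U) \<and> rcs U \<subseteq> S"
    and "rcs M \<subseteq> S"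
  shows "expand \<Delta>2 k (map_rcs g M) = expand \<Delta>1 k M"
  using assms(2)
proof (induction k arbitrary: M)
  case (Suc k)
  have u: "unfold (defs \<Delta>2) (map_rcs g M) = map_rcs g (unfold (defs \<Delta>1) M) \<and>
      rcs (unfold (defs \<Delta>1) M) \<subseteq> S"
  proof (cases M)
    case (Rec Ts r ys)
    with Suc.prems closed[of r] show ?thesis
      by (auto simp: map_rcs_instantiate map_rcs_set_binders) (auto simp: instantiate_eq)
  qed (use Suc.prems in auto)
  show ?case
  proof (cases "unfold (defs \<Delta>1) M")
    case (App Ts h Ns)
    with u Suc.IH show ?thesis by (simp add: UN_subset_iff)
  qed (use u in simp_all)
qed simp

subsection \<open>Substitutions and renaming apart\<close>

lemma wf_ctx_wt:
  assumes "wf_ctx sig \<Delta>" "(M, M') \<in> eqs \<Delta>"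
  obtains m T where "wt sig [] m M T" "wt sig [] m M' T"
proof -
  have "\<forall>(M, M')\<in>eqs \<Delta>. \<exists>m T. wt sig [] m M T \<and> wt sig [] m M' T"
    using assms(1) unfolding wf_ctx_def by (elim conjE)
  from bspec[OF this assms(2)] show thesis using that by auto
qed

lemma wf_ctx_defs:
  assumes "wf_ctx sig \<Delta>"
  shows "wf_defs sig (defs \<Delta>)"
  using assms unfolding wf_ctx_def wf_defs_def by (elim conjE)

lemma is_subst_wf: "is_subst sig \<Gamma> \<Longrightarrow> wf_ctx sig \<Gamma>"
  by (simp add: is_subst_def)

lemma is_subst_eqn:
  assumes "is_subst sig \<Gamma>" "(L, R) \<in> eqs \<Gamma>"
  shows "\<exists>H xs. L = Meta [] H xs \<and> fv R \<subseteq> set xs \<and> binders R = []"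
proof -
  have "\<forall>(L, R)\<in>eqs \<Gamma>. \<exists>H xs. L = Meta [] H xs \<and> fv R \<subseteq> set xs \<and> binders R = []"
    using assms(1) unfolding is_subst_def by (elim conjE)
  from bspec[OF this assms(2)] show ?thesis by simp
qed

lemma lookup_eqI:
  assumes "(Meta [] H xs, R) \<in> eqs \<Gamma>"
    and "\<And>xs' R'. (Meta [] H xs', R') \<in> eqs \<Gamma> \<Longrightarrow> xs' = xs \<and> R' = R"
  shows "lookup \<Gamma> H = Some (xs, R)"
proof -
  have "(THE p. case p of (xs, R) \<Rightarrow> (Meta [] H xs, R) \<in> eqs \<Gamma>) = (xs, R)"
  proof (rule the_equality)
    fix p :: "'a var list \<times> ('a, 'b) trm"
    assume p: "case p of (xs, R) \<Rightarrow> (Meta [] H xs, R) \<in> eqs \<Gamma>"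
    obtain xs' R' where "p = (xs', R')" by (cases p)
    with p assms(2)[of xs' R'] show "p = (xs, R)" by simp
  qed (use assms(1) in simp)
  then show ?thesis
    using assms(1) by (auto simp: lookup_def sdom_def)
qed

lemma lookup_None: "H \<notin> sdom \<Gamma> \<Longrightarrow> lookup \<Gamma> H = None"
  by (simp add: lookup_def)

lemma dom_lookup: "dom (lookup \<Gamma>) = sdom \<Gamma>"
  by (auto simp: lookup_def split: if_splits)

lemma is_subst_unique:
  assumes "is_subst sig \<Gamma>" "(Meta [] H xs, R) \<in> eqs \<Gamma>" "(Meta [] H xs', R') \<in> eqs \<Gamma>"
  shows "xs' = xs \<and> R' = R"
proof -
  have "\<forall>H xs R xs' R'. (Meta [] H xs, R) \<in> eqs \<Gamma> \<and> (Meta [] H xs', R') \<in> eqs \<Gamma>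
      \<longrightarrow> xs = xs' \<and> R = R'"
    using assms(1) unfolding is_subst_def by (elim conjE)
  with assms(2,3) show ?thesis by metis
qed

lemma lookup_iff:
  assumes "is_subst sig \<Gamma>"
  shows "lookup \<Gamma> H = Some (xs, R) \<longleftrightarrow> (Meta [] H xs, R) \<in> eqs \<Gamma>"
proof
  assume l: "lookup \<Gamma> H = Some (xs, R)"
  then have "H \<in> sdom \<Gamma>" by (auto simp: lookup_def split: if_splits)
  then obtain xs' R' where e: "(Meta [] H xs', R') \<in> eqs \<Gamma>" by (auto simp: sdom_def)
  with lookup_eqI[OF e is_subst_unique[OF assms e]] l show "(Meta [] H xs, R) \<in> eqs \<Gamma>" by simp
next
  assume e: "(Meta [] H xs, R) \<in> eqs \<Gamma>"
  show "lookup \<Gamma> H = Some (xs, R)"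
    by (rule lookup_eqI[OF e is_subst_unique[OF assms e]])
qed

lemma wf_bodies_lookup:
  assumes "is_subst sig \<Gamma>"
  shows "wf_bodies sig (lookup \<Gamma>)"
  unfolding wf_bodies_def lookup_iff[OF assms]
proof (intro allI impI)
  fix H zs R assume e: "(Meta [] H zs, R) \<in> eqs \<Gamma>"
  then obtain m T where w: "wt sig [] m (Meta [] H zs) T" "wt sig [] m R T"
    by (rule wf_ctx_wt[OF is_subst_wf[OF assms]])
  moreover have "fv R \<subseteq> set zs"
    using is_subst_eqn[OF assms e] by simp
  ultimately show "vars_of_types [] zs (doms (mty H)) \<and>
      wt sig [] (mtag H) R (Ty [] (cod (mty H))) \<and> fv R \<subseteq> set zs"
    using wt_MetaD[OF w(1)] by auto
qed

section \<open>The offset and the renaming inside \<open>rename_apart\<close>, and a left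
  inverse\<close>

definition fresh :: "('b, 'c) ctx \<Rightarrow> nat" where
  "fresh \<Delta> = Suc (Max (insert 0 (rname ` dom (defs \<Delta>))))"

definition raise :: "nat \<Rightarrow> 'b rconst \<Rightarrow> 'b rconst" where
  "raise N r = RConst (N + rname r) (rty r)"

text \<open>Undoes \<open>raise N\<close> and fixes the names below \<open>N\<close>, so both copies
  of a recursion constant of \<Delta> go to the same constant.\<close>

definition lower :: "nat \<Rightarrow> 'b rconst \<Rightarrow> 'b rconst" where
  "lower N r = (if rname r < N then r else RConst (rname r - N) (rty r))"

lemma raise_simps [simp]: "rname (raise N r) = N + rname r" "rty (raise N r) = rty r"
  by (simp_all add: raise_def)

lemma lower_raise [simp]: "lower N (raise N r) = r"
  by (cases r) (simp add: lower_def raise_def)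

lemma rname_fresh:
  assumes "finite (dom (defs \<Delta>))" "defs \<Delta> r = Some U"
  shows "rname r < fresh \<Delta>"
  using assms by (auto simp: fresh_def less_Suc_eq_le intro!: Max_ge)

lemma eqs_rename_apart:
  "eqs (rename_apart \<Delta> \<Gamma>) =
    {(map_rcs (raise (fresh \<Delta>)) M, map_rcs (raise (fresh \<Delta>)) M') |M M'. (M, M') \<in> eqs \<Gamma>}"
  by (simp add: rename_apart_def Let_def fresh_def raise_def[abs_def])

lemma defs_rename_apart:
  "defs (rename_apart \<Delta> \<Gamma>) r =
    (if fresh \<Delta> \<le> rname r
     then map_option (map_rcs (raise (fresh \<Delta>))) (defs \<Gamma> (RConst (rname r - fresh \<Delta>) (rty r)))
     else None)"
  by (simp add: rename_apart_def Let_def fresh_def raise_def[abs_def])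

text \<open>The result of the construction defines the same recursion constants as \<Delta>, so
  \<open>subst_ctx\<close> and \<open>compose\<close> rename a unifier in the same way.\<close>

lemma rename_apart_cong:
  assumes "dom (defs \<Delta>) = dom (defs \<Delta>')"
  shows "rename_apart \<Delta> \<Gamma> = rename_apart \<Delta>' \<Gamma>"
  by (simp add: rename_apart_def assms)

lemma map_rcs_eq_Meta: "map_rcs g M = Meta Ts H ys \<longleftrightarrow> M = Meta Ts H ys"
  by (cases M) auto

lemma Meta_in_rename_apart:
  "(Meta Ts H xs, R) \<in> eqs (rename_apart \<Delta> \<Gamma>) \<longleftrightarrow>
    (\<exists>R'. (Meta Ts H xs, R') \<in> eqs \<Gamma> \<and> R = map_rcs (raise (fresh \<Delta>)) R')"
  unfolding eqs_rename_apart by (auto simp: map_rcs_eq_Meta) (metis map_rcs_eq_Meta)+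

lemma sdom_rename_apart [simp]: "sdom (rename_apart \<Delta> \<Gamma>) = sdom \<Gamma>"
  by (auto simp: sdom_def Meta_in_rename_apart)

lemma lookup_rename_apart:
  assumes "is_subst sig \<Gamma>"
  shows "lookup (rename_apart \<Delta> \<Gamma>) = map_bodies (map_rcs (raise (fresh \<Delta>))) (lookup \<Gamma>)"
proof
  fix H
  show "lookup (rename_apart \<Delta> \<Gamma>) H = map_bodies (map_rcs (raise (fresh \<Delta>))) (lookup \<Gamma>) H"
  proof (cases "lookup \<Gamma> H")
    case None
    then have "H \<notin> sdom \<Gamma>" using dom_lookup[of \<Gamma>] by auto
    with None show ?thesis by (simp add: map_bodies_def lookup_None)
  next
    case (Some p)
    obtain xs R where p: "p = (xs, R)" by (cases p)
    with Some have e: "(Meta [] H xs, R) \<in> eqs \<Gamma>" by (simp add: lookup_iff[OF assms])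
    have "lookup (rename_apart \<Delta> \<Gamma>) H = Some (xs, map_rcs (raise (fresh \<Delta>)) R)"
    proof (rule lookup_eqI)
      show "(Meta [] H xs, map_rcs (raise (fresh \<Delta>)) R) \<in> eqs (rename_apart \<Delta> \<Gamma>)"
        using e by (auto simp: Meta_in_rename_apart)
      fix xs' R' assume "(Meta [] H xs', R') \<in> eqs (rename_apart \<Delta> \<Gamma>)"
      then obtain R0 where R0: "(Meta [] H xs', R0) \<in> eqs \<Gamma>" "R' = map_rcs (raise (fresh \<Delta>)) R0"
        by (auto simp: Meta_in_rename_apart)
      from is_subst_unique[OF assms e R0(1)] R0(2)
      show "xs' = xs \<and> R' = map_rcs (raise (fresh \<Delta>)) R" by simp
    qed
    with Some p show ?thesis by (simp add: map_bodies_def)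
  qed
qed

lemma wf_bodies_map_rcs:
  assumes "wf_bodies sig \<sigma>"
  shows "wf_bodies sig (map_bodies (map_rcs (raise N)) \<sigma>)"
  unfolding wf_bodies_def map_bodies_Some
proof (intro allI impI, elim exE conjE)
  fix H zs R R'
  assume "\<sigma> H = Some (zs, R')" and R: "R = map_rcs (raise N) R'"
  note b = wf_bodiesD[OF assms(1) this(1)]
  show "vars_of_types [] zs (doms (mty H)) \<and> wt sig [] (mtag H) R (Ty [] (cod (mty H))) \<and>
      fv R \<subseteq> set zs"
    using R b(1,3) wt_map_rcs[OF _ b(2), of "raise N"] by auto
qed

lemma rcs_defs:
  assumes "wf_ctx sig \<Delta>" "defs \<Delta> r = Some U"
  shows "rcs U \<subseteq> dom (defs \<Delta>)"
proof -
  have "rcs U \<subseteq> ctx_rcs \<Delta>"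
    using ranI[of "defs \<Delta>", OF assms(2)] by (auto simp: ctx_rcs_def)
  also have "\<dots> \<subseteq> dom (defs \<Delta>)"
    using assms(1) by (simp add: wf_ctx_def)
  finally show ?thesis .
qed

lemma rcs_eqs:
  assumes "wf_ctx sig \<Delta>" "(M, M') \<in> eqs \<Delta>"
  shows "rcs M \<union> rcs M' \<subseteq> dom (defs \<Delta>)"
proof -
  have "rcs M \<union> rcs M' \<subseteq> ctx_rcs \<Delta>"
    using assms(2) unfolding ctx_rcs_def by auto
  also have "\<dots> \<subseteq> dom (defs \<Delta>)"
    using assms(1) by (simp add: wf_ctx_def)
  finally show ?thesis .
qed

lemma defs_subst_ctx:
  assumes "defs \<Delta> r = Some U"
  shows "defs (subst_ctx \<Delta> \<Gamma>) r = Some (subst (rename_apart \<Delta> \<Gamma>) U)"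
  using assms by (simp add: subst_ctx_def Let_def map_add_def)

text \<open>A raised name lies beyond all names defined in \<Delta>, so no definition of \<Delta>
  overrides it.\<close>

lemma defs_subst_ctx_raise:
  assumes "finite (dom (defs \<Delta>))"
  shows "defs (subst_ctx \<Delta> \<Gamma>) (raise (fresh \<Delta>) r)
    = map_option (map_rcs (raise (fresh \<Delta>))) (defs \<Gamma> r)"
proof -
  have "defs \<Delta> (raise (fresh \<Delta>) r) = None"
    using rname_fresh[OF assms, of "raise (fresh \<Delta>) r"] by fastforce
  then show ?thesis
    by (cases r) (simp add: subst_ctx_def Let_def map_add_def defs_rename_apart)
qed

lemma defs_compose: "defs (compose \<Gamma>1 \<Gamma>2) = defs (subst_ctx \<Gamma>1 \<Gamma>2)"
  by (simp add: compose_def subst_ctx_def Let_def)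

lemma wf_defs_subst_ctx:
  assumes "wf_ctx sig \<Delta>" "is_subst sig \<Gamma>"
  shows "wf_defs sig (defs (subst_ctx \<Delta> \<Gamma>))"
  unfolding wf_defs_def
proof (intro allI impI)
  fix r U assume U: "defs (subst_ctx \<Delta> \<Gamma>) r = Some U"
  show "wt sig [] Con U (rty r) \<and> fv U = {}"
  proof (cases "defs \<Delta> r")
    case (Some V)
    then have V: "wt sig [] Con V (rty r)" "fv V = {}"
      using wf_ctx_defs[OF assms(1)] by (auto simp: wf_defs_def)
    note b = wf_bodies_map_rcs[OF wf_bodies_lookup[OF assms(2)], of "fresh \<Delta>"]
    have "U = replace (map_bodies (map_rcs (raise (fresh \<Delta>))) (lookup \<Gamma>)) V"
      using U defs_subst_ctx[OF Some] by (simp add: subst_def lookup_rename_apart[OF assms(2)])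
    with wt_replace[OF b V(1)] fv_replace[OF b V(1)] V(2) show ?thesis by auto
  next
    case None
    let ?r = "RConst (rname r - fresh \<Delta>) (rty r)"
    from None U have "defs (rename_apart \<Delta> \<Gamma>) r = Some U"
      by (simp add: subst_ctx_def Let_def map_add_def)
    then obtain V where V: "defs \<Gamma> ?r = Some V" "U = map_rcs (raise (fresh \<Delta>)) V"
      by (auto simp: defs_rename_apart split: if_splits)
    moreover have "wf_defs sig (defs \<Gamma>)"
      by (rule wf_ctx_defs[OF is_subst_wf[OF assms(2)]])
    ultimately have "wt sig [] Con V (rty r)" "fv V = {}"
      using wf_defsD[of sig "defs \<Gamma>" ?r V] by (simp_all add: wf_defs_def)
    with V wt_map_rcs[of "raise (fresh \<Delta>)" sig "[]" Con V] show ?thesis by simp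
  qed
qed

lemma expand_subst_ctx_raise:
  assumes "wf_ctx sig \<Delta>" "is_subst sig \<Gamma>" "rcs M \<subseteq> dom (defs \<Gamma>)"
  shows "expand (subst_ctx \<Delta> \<Gamma>) k (map_rcs (raise (fresh \<Delta>)) M) = expand \<Gamma> k M"
proof (rule expand_map_rcs[OF _ assms(3)])
  fix r assume "r \<in> dom (defs \<Gamma>)"
  then obtain U where "defs \<Gamma> r = Some U" by blast
  moreover have "wf_ctx sig \<Gamma>" using assms(2) by (simp add: is_subst_def)
  moreover have "finite (dom (defs \<Delta>))" using assms(1) by (simp add: wf_ctx_def)
  ultimately show "\<exists>U. defs \<Gamma> r = Some U \<and>
      defs (subst_ctx \<Delta> \<Gamma>) (raise (fresh \<Delta>) r) = Some (map_rcs (raise (fresh \<Delta>)) U) \<and>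
      rcs U \<subseteq> dom (defs \<Gamma>)"
    using defs_subst_ctx_raise[of \<Delta> \<Gamma> r] rcs_defs[of sig \<Gamma> r] by simp
qed

lemma rcs_lookup:
  assumes "is_subst sig \<Gamma>" "lookup \<Gamma> H = Some (zs, R)"
  shows "rcs R \<subseteq> dom (defs \<Gamma>)"
proof -
  have "(Meta [] H zs, R) \<in> eqs \<Gamma>"
    using assms(2) by (simp add: lookup_iff[OF assms(1)])
  from rcs_eqs[OF is_subst_wf[OF assms(1)] this] show ?thesis by simp
qed

text \<open>If \<^term>\<open>\<Gamma>\<close> carries the instantiated definitions of \<^term>\<open>\<Delta>\<close>, then the two copies of
  each recursion constant in \<^term>\<open>subst_ctx \<Delta> \<Gamma>\<close> can be identified.\<close>

lemma expand_subst_ctx_lower: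
  fixes sig :: "'c \<Rightarrow> 'b ty"
  assumes \<Delta>: "wf_ctx sig \<Delta>" and \<Gamma>: "is_subst sig \<Gamma>"
    and defs: "\<And>r. defs \<Gamma> r = map_option (subst \<Gamma>) (defs \<Delta> r)"
    and M: "rcs M \<subseteq> dom (defs \<Delta>)"
  shows "expand (subst_ctx \<Delta> \<Gamma>) k (subst (rename_apart \<Delta> \<Gamma>) M) = expand \<Gamma> k (subst \<Gamma> M)"
proof -
  let ?N = "fresh \<Delta>"
  let ?\<gamma>' = "map_bodies (map_rcs (raise ?N)) (lookup \<Gamma>)"
  \<comment> \<open>Bodies of \<Delta> acquire raised constants through the substitution, and raised
    bodies mention only raised constants. So the union of both copies is closed under
    unfolding.\<close>
  define S where "S = dom (defs \<Delta>) \<union> raise ?N ` dom (defs \<Delta>)"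
  have dom: "dom (defs \<Gamma>) = dom (defs \<Delta>)" using defs by (auto simp: dom_def)
  have fin: "finite (dom (defs \<Delta>))" using \<Delta> by (simp add: wf_ctx_def)
  have sub: "subst (rename_apart \<Delta> \<Gamma>) = replace ?\<gamma>'" "subst \<Gamma> = replace (lookup \<Gamma>)"
    by (simp_all add: fun_eq_iff subst_def lookup_rename_apart[OF \<Gamma>])
  have lower: "lower ?N r = r" if "r \<in> dom (defs \<Delta>)" for r
    using that rname_fresh[OF fin] by (auto simp: lower_def)
  have "lower ?N \<circ> raise ?N = (\<lambda>r. r)" by (simp add: fun_eq_iff)
  then have lr: "map_rcs (lower ?N) (map_rcs (raise ?N) X) = X" for X :: "('b, 'c) trm"
    by (simp add: map_rcs_map_rcs map_rcs_id)
  then have \<gamma>: "map_bodies (map_rcs (lower ?N)) ?\<gamma>' = lookup \<Gamma>"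
    by (auto simp: fun_eq_iff map_bodies_def option.map_comp comp_def case_prod_unfold
        intro: option.map_ident_strong)
  have rep: "map_rcs (lower ?N) (replace ?\<gamma>' X) = replace (lookup \<Gamma>) X"
    if "rcs X \<subseteq> dom (defs \<Delta>)" for X
  proof -
    have "map_rcs (lower ?N) X = X" using that lower by (intro map_rcs_id) auto
    then show ?thesis by (simp only: map_rcs_replace \<gamma>)
  qed
  have rcsS: "rcs (replace ?\<gamma>' X) \<subseteq> S" if "rcs X \<subseteq> dom (defs \<Delta>)" for X
  proof -
    have "rcs (replace ?\<gamma>' X) \<subseteq> rcs X \<union> raise ?N ` dom (defs \<Delta>)"
    proof (rule rcs_replace)
      fix H zs R assume "?\<gamma>' H = Some (zs, R)"
      then obtain R' where "lookup \<Gamma> H = Some (zs, R')" "R = map_rcs (raise ?N) R'"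
        by (auto simp: map_bodies_Some)
      with rcs_lookup[OF \<Gamma>, of H zs R'] dom show "rcs R \<subseteq> raise ?N ` dom (defs \<Delta>)"
        by auto
    qed
    with that show ?thesis by (auto simp: S_def)
  qed
  have "\<exists>U. defs (subst_ctx \<Delta> \<Gamma>) r = Some U \<and>
      defs \<Gamma> (lower ?N r) = Some (map_rcs (lower ?N) U) \<and> rcs U \<subseteq> S" if "r \<in> S" for r
  proof -
    from that consider "r \<in> dom (defs \<Delta>)" | s where "s \<in> dom (defs \<Delta>)" "r = raise ?N s"
      by (auto simp: S_def)
    then show ?thesis
    proof cases
      case 1
      then obtain U where U: "defs \<Delta> r = Some U" by blast
      with rcs_defs[OF \<Delta> U] show ?thesis
        using defs_subst_ctx[OF U, of \<Gamma>] defs[of r] lower[OF 1] rep rcsS by (simp add: sub)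
    next
      case 2
      then obtain U where U: "defs \<Delta> s = Some U" by blast
      have "rcs (replace (lookup \<Gamma>) U) \<subseteq> dom (defs \<Gamma>)"
        using defs[of s] U \<Gamma> rcs_defs[of sig \<Gamma> s] by (simp add: sub is_subst_def)
      then show ?thesis
        using defs_subst_ctx_raise[OF fin, of \<Gamma> s] 2 U defs[of s]
        by (auto simp: sub lr S_def dom)
    qed
  qed
  from expand_map_rcs[of S "subst_ctx \<Delta> \<Gamma>" \<Gamma> "lower ?N", OF this rcsS[OF M]] rep[OF M]
  show ?thesis by (simp add: sub)
qed


subsection \<open>Saturated contexts\<close>

locale saturated_ctx =
  fixes sig :: "'c \<Rightarrow> 'b ty" and \<Delta> :: "('b, 'c) ctx"
  assumes wf: "wf_ctx sig \<Delta>" and sat: "saturated \<Delta>" and no_contra: "\<not> contra \<Delta>"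
begin

lemma Eqn_items [simp]: "Eqn M M' \<in> items \<Delta> \<longleftrightarrow> (M, M') \<in> eqs \<Delta>"
  by (auto simp: items_def)

lemma Contra_items [simp]: "Contra \<notin> items \<Delta>"
  using no_contra by (auto simp: items_def)

lemma closed: "rule \<Delta> C \<Longrightarrow> \<exists>X\<in>C. X \<subseteq> items \<Delta>"
  using sat unfolding saturated_def by blast

lemma eq_sym: "(M, M') \<in> eqs \<Delta> \<Longrightarrow> (M', M) \<in> eqs \<Delta>"
  using closed[OF rule.sym] by auto

lemma eq_trans: "(M, M') \<in> eqs \<Delta> \<Longrightarrow> (M', M'') \<in> eqs \<Delta> \<Longrightarrow> (M, M'') \<in> eqs \<Delta>"
  using closed[OF rule.trans] by auto

lemma eq_Meta_tag:
  assumes "(Meta Ts G xs, Meta Ts H ys) \<in> eqs \<Delta>"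
  shows "mtag G = mtag H"
  by (rule wf_ctx_wt[OF wf assms]) (metis wt_MetaD(1))

lemma eq_App_tag:
  assumes "(Meta Ts H ys, App Ss h Ns) \<in> eqs \<Delta>"
  shows "mtag H = Con"
  by (rule wf_ctx_wt[OF wf assms]) (metis wt_MetaD(1) wt_AppD(1))

lemma eq_Rec_tag:
  assumes "(Meta Ts H ys, Rec Ss r xs) \<in> eqs \<Delta>"
  shows "mtag H = Recu"
  by (rule wf_ctx_wt[OF wf assms]) (metis wt_MetaD(1) wt_RecD(1))

lemma eq_App_Rec:
  assumes "(App Ts h Ns, Rec Ss r xs) \<in> eqs \<Delta>"
  shows False
  by (rule wf_ctx_wt[OF wf assms]) (metis wt_AppD(1) wt_RecD(1) tag.distinct(1))

lemma eq_Meta_vars: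
  assumes "(Meta [] H ys, M) \<in> eqs \<Delta>"
  shows "vars_of_types [] ys (doms (mty H))" "distinct ys"
proof -
  show "vars_of_types [] ys (doms (mty H))"
    by (rule wf_ctx_wt[OF wf assms]) (use wt_MetaD(3) in fastforce)
  then show "distinct ys" by (rule vars_of_types_distinct)
qed

text \<open>A clash would put \<open>Contra\<close> into \<Delta>. The symmetric equation serves the
  case of a constructor against a variable, since SIMP-F1 expects the variable on the left.\<close>

lemma head_eq:
  assumes "(App [] h Ns, App [] h' Ns') \<in> eqs \<Delta>"
  shows "h = h'"
proof (rule ccontr)
  assume "h \<noteq> h'"
  then have "rule \<Delta> {{Contra}}"
    using assms eq_sym[OF assms]
    by (cases h; cases h') (auto intro: rule.simp_f1 rule.simp_f2 rule.simp_f3)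
  from closed[OF this] show False by simp
qed

lemma args_length:
  assumes "(App [] h Ns, App [] h Ns') \<in> eqs \<Delta>"
  shows "length Ns = length Ns'"
proof (rule wf_ctx_wt[OF wf assms])
  fix m T
  assume "wt sig [] m (App [] h Ns) T" "wt sig [] m (App [] h Ns') T"
  from this[THEN wt_AppD(2)] show ?thesis
    by (auto dest!: list_all2_lengthD)
qed

lemma args_eq:
  assumes "(App [] h Ns, App [] h Ns') \<in> eqs \<Delta>" "i < length Ns"
  shows "(Ns ! i, Ns' ! i) \<in> eqs \<Delta>"
  using closed[OF rule.simp[OF assms(1) args_length[OF assms(1)] assms(2)]] by simp

text \<open>If \<open>H\<close> were unresolved, PROJ-F would exclude a variable head outside
  \<open>ys\<close>, and IMIT or PROJ would supply an imitation. Its free variables lie in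
  \<open>ys\<close> even if those of the given right side do not, so it resolves
  \<open>H\<close>.\<close>

lemma resolved_App:
  assumes "(Meta [] H ys, App [] h Ns) \<in> eqs \<Delta>"
  shows "resolved \<Delta> H"
proof (rule ccontr)
  assume n: "\<not> resolved \<Delta> H"
  note tag = eq_App_tag[OF assms]
  have *: "resolved \<Delta> H"
    if "(Meta [] H ys, imitation h ys Ns Gs) \<in> eqs \<Delta>" "fv_head h \<subseteq> set ys" for Gs
  proof -
    have "fv (imitation h ys Ns Gs) \<subseteq> set ys"
      using that(2) by (fastforce simp: imitation_def frees_def in_set_conv_nth)
    then have "resolution \<Delta> H ys (imitation h ys Ns Gs)"
      using that(1) tag by (auto simp: resolution_def imitation_def)
    then show ?thesis by (auto simp: resolved_def)
  qed
  show False
  proof (cases h)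
    case (HVar y)
    have y: "y \<in> set ys"
    proof (rule ccontr)
      assume "y \<notin> set ys"
      from closed[OF rule.proj_f[OF assms[unfolded HVar] tag this]] show False by simp
    qed
    from closed[OF rule.proj[OF assms[unfolded HVar] tag y n]] y * n HVar freesD
    show False by fastforce
  next
    case (HCon c)
    from closed[OF rule.imit[OF assms[unfolded HCon] tag n]] * n HCon
    show False by fastforce
  qed
qed

text \<open>Either the equation itself resolves \<open>H\<close>, or some variable of
  \<open>xs\<close> is missing in \<open>ys\<close> and PRUNE supplies a resolution
  equation.\<close>

lemma resolved_Rec:
  assumes "(Meta [] H ys, Rec [] r xs) \<in> eqs \<Delta>"
  shows "resolved \<Delta> H"
proof (rule ccontr)
  assume n: "\<not> resolved \<Delta> H"
  note tag = eq_Rec_tag[OF assms]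
  have *: False if "(Meta [] H ys, Rec [] t ws) \<in> eqs \<Delta>" "set ws \<subseteq> set ys" for t ws
  proof -
    have "resolution \<Delta> H ys (Rec [] t ws)"
      using that tag by (simp add: resolution_def)
    with n show ?thesis by (auto simp: resolved_def)
  qed
  then have "\<not> set xs \<subseteq> set ys" using assms by blast
  from closed[OF rule.prune[OF assms tag this n]] * show False by fastforce
qed

lemma not_resolved_Meta:
  assumes "(Meta [] H ys, Meta [] G ws) \<in> eqs \<Delta>" "\<not> resolved \<Delta> H"
  shows "\<not> set ws \<subset> set ys"
proof
  assume "set ws \<subset> set ys"
  then have "resolution \<Delta> H ys (Meta [] G ws)"
    using assms(1) eq_Meta_tag[OF assms(1)] unfolding resolution_def by (cases "mtag H") auto
  with assms(2) show False by (auto simp: resolved_def)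
qed

text \<open>FF-S equates \<open>G xs\<close> with some \<open>F zs\<close>, where \<open>zs\<close>
  are the variables in positions on which \<open>xs\<close> and \<open>ys\<close> agree. If the
  lists differ, this is a proper subset of \<open>xs\<close>, and the equation resolves
  \<open>G\<close>.\<close>

lemma unresolved_same_args:
  assumes "(Meta [] G xs, Meta [] G ys) \<in> eqs \<Delta>" "\<not> resolved \<Delta> G"
  shows "xs = ys"
proof (rule ccontr)
  assume ne: "xs \<noteq> ys"
  from closed[OF rule.ff_s[OF assms(1) ne assms(2)]] obtain F zs
    where F: "(Meta [] G xs, Meta [] F zs) \<in> eqs \<Delta>"
      and zs: "set zs = {x. (x, x) \<in> set (zip xs ys)}" by auto
  have d: "distinct xs" "length xs = length ys"
    using eq_Meta_vars[OF assms(1)] eq_Meta_vars[OF eq_sym[OF assms(1)]] vars_of_types_length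
    by metis+
  from ne d obtain i where i: "i < length xs" "xs ! i \<noteq> ys ! i"
    using nth_equalityI by blast
  have "xs ! i \<notin> set zs"
    using i d by (auto simp: zs in_set_zip nth_eq_iff_index_eq)
  moreover have "set zs \<subseteq> set xs"
    by (auto simp: zs dest: set_zip_leftD)
  ultimately have "set zs \<subset> set xs" using i by auto
  with not_resolved_Meta[OF F assms(2)] show False by blast
qed

lemma eq_agree:
  assumes "(Meta [] H ys, M) \<in> eqs \<Delta>" "(Meta [] H zs, R) \<in> eqs \<Delta>" "fv R \<subseteq> set zs"
  shows "(rename ys zs R, M) \<in> eqs \<Delta>"
proof -
  \<comment> \<open>AGREE demands that the free variables of both right sides be covered by the
    arguments, which may fail for \<open>M\<close>. So it is applied to the reflexive equation of
    \<open>H ys\<close>, and \<open>M\<close> comes back by transitivity.\<close>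
  have "(Meta [] H ys, Meta [] H ys) \<in> eqs \<Delta>"
    using eq_trans[OF assms(1) eq_sym[OF assms(1)]] .
  moreover have "fv (Meta [] H ys) \<subseteq> set ys"
    by (auto dest: freesD)
  ultimately have "rule \<Delta> {{Eqn (Meta [] H ys) (rename ys zs R)}}"
    using assms(2,3) by (intro rule.agree)
  from closed[OF this] have "(Meta [] H ys, rename ys zs R) \<in> eqs \<Delta>" by simp
  from eq_trans[OF eq_sym[OF this] assms(1)] show ?thesis .
qed

lemma eq_Rec_unfold:
  assumes "(Rec [] r xs, Rec [] s ys) \<in> eqs \<Delta>"
  obtains U V where "defs \<Delta> r = Some U" "defs \<Delta> s = Some V"
    "(instantiate U xs, instantiate V ys) \<in> eqs \<Delta>"
proof -
  have "r \<in> dom (defs \<Delta>)" "s \<in> dom (defs \<Delta>)"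
    using rcs_eqs[OF wf assms] by auto
  then obtain U V where "defs \<Delta> r = Some U" "defs \<Delta> s = Some V" by blast
  with closed[OF rule.rec_exp[OF assms this]] that show thesis by simp
qed

lemma eq_instantiate:
  assumes "(M, M') \<in> eqs \<Delta>"
  obtains xs where "(instantiate M xs, instantiate M' xs) \<in> eqs \<Delta>"
    "vars_of_types [] xs (binders M)" "set xs \<inter> (fv M \<union> fv M') = {}"
  using closed[OF rule.inst[OF assms]] by auto

lemma finite_UV: "finite (UV \<Delta>)"
proof -
  have mvs: "finite (mvs M)" for M :: "('b, 'c) trm"
    by (induction M) auto
  have "finite (eqs \<Delta>)" "finite (dom (defs \<Delta>))" using wf by (simp_all add: wf_ctx_def)
  then show ?thesis
    unfolding UV_def by (auto simp: finite_ran mvs)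
qed

lemma mvs_eq: "(M, M') \<in> eqs \<Delta> \<Longrightarrow> mvs M \<union> mvs M' \<subseteq> UV \<Delta>"
  unfolding UV_def by auto

end

subsection \<open>Choices of resolution and representative equations\<close>

locale chosen = saturated_ctx sig \<Delta> for sig :: "'c \<Rightarrow> 'b ty" and \<Delta> :: "('b, 'c) ctx" +
  fixes \<rho> :: "('b, 'c) bodies" and R :: "'b mvar set"
  assumes choice: "unif_choice \<Delta> \<rho> R"
begin

lemma dom_rho: "dom \<rho> = UV \<Delta>"
  using choice unfolding unif_choice_def by (elim conjE)

lemma R_unresolved: "R \<subseteq> unresolved \<Delta>"
  using choice unfolding unif_choice_def by (elim conjE)

lemma R_not_resolved: "H \<in> R \<Longrightarrow> \<not> resolved \<Delta> H"
  using R_unresolved by (auto simp: unresolved_def)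

lemma rho_resolved:
  assumes "H \<in> UV \<Delta>" "resolved \<Delta> H"
  obtains ys M where "\<rho> H = Some (ys, M)" "resolution \<Delta> H ys M"
proof -
  have "\<forall>H\<in>UV \<Delta>. resolved \<Delta> H \<longrightarrow> (\<exists>ys M. \<rho> H = Some (ys, M) \<and> resolution \<Delta> H ys M)"
    using choice unfolding unif_choice_def by (elim conjE)
  with assms that show thesis by blast
qed

lemma rho_class:
  assumes "H \<in> unresolved \<Delta>"
  obtains G zs where "mv_equiv \<Delta> `` {H} \<inter> R = {G}"
    "\<forall>H'. (H, H') \<in> mv_equiv \<Delta> \<longrightarrow> (\<exists>ys. \<rho> H' = Some (ys, Meta [] G zs) \<and> distinct ys \<and>
      distinct zs \<and> set zs = set ys \<and> ((Meta [] H' ys, Meta [] G zs) \<in> eqs \<Delta> \<or>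
        (H' = G \<and> ys = zs \<and> vars_of_types [] zs (doms (mty G)))))"
proof -
  have "\<forall>K\<in>unresolved \<Delta> // mv_equiv \<Delta>. \<exists>G zs. K \<inter> R = {G} \<and>
      (\<forall>H\<in>K. \<exists>ys. \<rho> H = Some (ys, Meta [] G zs) \<and> distinct ys \<and> distinct zs \<and>
        set zs = set ys \<and> ((Meta [] H ys, Meta [] G zs) \<in> eqs \<Delta> \<or>
          (H = G \<and> ys = zs \<and> vars_of_types [] zs (doms (mty G)))))"
    using choice unfolding unif_choice_def by (elim conjE)
  from bspec[OF this quotientI[OF assms]] that show thesis by blast
qed

lemma mv_equiv_refl: "H \<in> unresolved \<Delta> \<Longrightarrow> (H, H) \<in> mv_equiv \<Delta>"
  by (simp add: mv_equiv_def)

text \<open>\<open>G\<close> is the only representative in its class, and a representative equation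
  of \<open>G\<close> with itself has equal argument lists by \<open>unresolved_same_args\<close>.
  So \<rho> is the identity on representatives, and iterating it can come to rest.\<close>

lemma rho_rep:
  assumes "G \<in> R"
  obtains zs where "\<rho> G = Some (zs, Meta [] G zs)"
proof -
  from assms R_unresolved have G: "G \<in> unresolved \<Delta>" by blast
  obtain G' zs where c: "mv_equiv \<Delta> `` {G} \<inter> R = {G'}"
    "\<forall>H'. (G, H') \<in> mv_equiv \<Delta> \<longrightarrow> (\<exists>ys. \<rho> H' = Some (ys, Meta [] G' zs) \<and> distinct ys \<and>
      distinct zs \<and> set zs = set ys \<and> ((Meta [] H' ys, Meta [] G' zs) \<in> eqs \<Delta> \<or>
        (H' = G' \<and> ys = zs \<and> vars_of_types [] zs (doms (mty G')))))"
    by (rule rho_class[OF G])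
  have "G \<in> mv_equiv \<Delta> `` {G} \<inter> R" using mv_equiv_refl[OF G] assms by simp
  then have "G' = G" unfolding c(1) by simp
  with c(2) mv_equiv_refl[OF G] obtain ys where ys: "\<rho> G = Some (ys, Meta [] G zs)"
    "(Meta [] G ys, Meta [] G zs) \<in> eqs \<Delta> \<or> ys = zs" by blast
  then have "ys = zs"
    using unresolved_same_args R_not_resolved[OF assms] by blast
  with ys that show thesis by simp
qed

text \<open>The equation puts both metavariables into one class, which contains a single
  representative.\<close>

lemma reps_eq:
  assumes "G \<in> R" "H \<in> R" "(Meta [] G xs, Meta [] H ys) \<in> eqs \<Delta>"
  shows "G = H"
proof -
  from assms R_unresolved have G: "G \<in> unresolved \<Delta>" and H: "H \<in> unresolved \<Delta>" by auto
  with assms(3) have "(G, H) \<in> mv_equiv \<Delta>" by (auto simp: mv_equiv_def)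
  then have "G \<in> mv_equiv \<Delta> `` {G} \<inter> R" "H \<in> mv_equiv \<Delta> `` {G} \<inter> R"
    using mv_equiv_refl[OF G] assms(1,2) by auto
  moreover obtain G' where "mv_equiv \<Delta> `` {G} \<inter> R = {G'}"
    by (rule rho_class[OF G])
  ultimately show ?thesis by (metis singletonD)
qed

text \<open>The identity equation in case \<open>rep\<close> covers a representative that occurs
  only in definition bodies, hence in no equation of \<Delta>.\<close>

lemma rho_cases:
  assumes "\<rho> H = Some (zs, M)"
  obtains (eq) "(Meta [] H zs, M) \<in> eqs \<Delta>" "fv M \<subseteq> set zs" "resolution \<Delta> H zs M"
    | (rep) G xs where "M = Meta [] G xs" "G \<in> R" "set xs = set zs"
        "(Meta [] H zs, M) \<in> eqs \<Delta> \<or> (M = Meta [] H zs \<and> vars_of_types [] zs (doms (mty H)))"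
proof -
  have H: "H \<in> UV \<Delta>" using assms dom_rho by blast
  show thesis
  proof (cases "resolved \<Delta> H")
    case True
    with rho_resolved[OF H] assms have r: "resolution \<Delta> H zs M" by force
    then have "(Meta [] H zs, M) \<in> eqs \<Delta>"
      using eq_sym unfolding resolution_def by blast
    moreover have "fv M \<subseteq> set zs"
      using r unfolding resolution_def by (auto split: tag.splits dest!: freesD)
    ultimately show thesis using r eq by blast
  next
    case False
    with H have u: "H \<in> unresolved \<Delta>" by (simp add: unresolved_def)
    obtain G xs where c: "mv_equiv \<Delta> `` {H} \<inter> R = {G}"
      "\<forall>H'. (H, H') \<in> mv_equiv \<Delta> \<longrightarrow> (\<exists>ys. \<rho> H' = Some (ys, Meta [] G xs) \<and> distinct ys \<and>
        distinct xs \<and> set xs = set ys \<and> ((Meta [] H' ys, Meta [] G xs) \<in> eqs \<Delta> \<or>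
          (H' = G \<and> ys = xs \<and> vars_of_types [] xs (doms (mty G)))))"
      by (rule rho_class[OF u])
    from c(2)[rule_format, OF mv_equiv_refl[OF u]] assms have "M = Meta [] G xs" "set xs = set zs"
      "(Meta [] H zs, M) \<in> eqs \<Delta> \<or> (M = Meta [] H zs \<and> vars_of_types [] zs (doms (mty H)))"
      by auto
    with rep c(1) show thesis by blast
  qed
qed

lemma rho_eqs:
  assumes "\<rho> H = Some (zs, M)"
  shows "((Meta [] H zs, M) \<in> eqs \<Delta> \<or> (M = Meta [] H zs \<and> vars_of_types [] zs (doms (mty H))))
    \<and> fv M \<subseteq> set zs"
  using assms by (cases rule: rho_cases) (auto dest: freesD)

lemma wf_rho: "wf_bodies sig \<rho>"
  unfolding wf_bodies_def
proof (intro allI impI)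
  fix H zs M assume "\<rho> H = Some (zs, M)"
  from rho_eqs[OF this] have fv: "fv M \<subseteq> set zs" and
    "(Meta [] H zs, M) \<in> eqs \<Delta> \<or> (M = Meta [] H zs \<and> vars_of_types [] zs (doms (mty H)))"
    by blast+
  then show "vars_of_types [] zs (doms (mty H)) \<and> wt sig [] (mtag H) M (Ty [] (cod (mty H))) \<and>
      fv M \<subseteq> set zs"
  proof (elim disjE conjE)
    assume e: "(Meta [] H zs, M) \<in> eqs \<Delta>"
    show ?thesis
      by (rule wf_ctx_wt[OF wf e]) (use fv eq_Meta_vars[OF e] wt_MetaD(1,2) in blast)
  next
    assume "M = Meta [] H zs" and v: "vars_of_types [] zs (doms (mty H))"
    with fv show ?thesis using wt_MetaI[of "[]" "[]" zs H sig] by simp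
  qed
qed

lemma rho_replace_fixed:
  assumes "wt sig E m M T" "mvs M \<inter> UV \<Delta> \<subseteq> R"
  shows "replace \<rho> M = M"
  using assms
proof (induction M arbitrary: E m T)
  case (App Ts h Ns)
  have "replace \<rho> N = N" if "N \<in> set Ns" for N
  proof -
    from wt_arg[OF App.prems(1) that] obtain S where "wt sig (Ts @ E) Recu N S" by blast
    from App.IH[OF that this] App.prems(2) that show ?thesis by auto
  qed
  then show ?case by (auto intro!: map_idI)
next
  case (Meta Ts H ys)
  show ?case
  proof (cases "H \<in> R")
    case True
    then obtain zs where zs: "\<rho> H = Some (zs, Meta [] H zs)" by (rule rho_rep)
    with map_renaming[of zs ys] wf_bodiesD[OF wf_rho zs] wt_MetaD[OF Meta.prems(1)]
    show ?thesis by (simp add: rename_eq lift_0)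
  next
    case False
    with Meta dom_rho have "\<rho> H = None" by auto
    then show ?thesis by simp
  qed
qed simp

lemma wt_rho_iter: "wt sig E m M T \<Longrightarrow> wt sig E m ((replace \<rho> ^^ i) M) T"
  by (induction i) (auto intro: wt_replace[OF wf_rho])

lemma replace_rho_eq:
  assumes "(Meta [] H ys, M) \<in> eqs \<Delta>"
  obtains zs N where "\<rho> H = Some (zs, N)" "replace \<rho> (Meta [] H ys) = rename ys zs N"
    "(rename ys zs N, M) \<in> eqs \<Delta>" "length zs = length ys"
proof -
  have "H \<in> UV \<Delta>" using mvs_eq[OF assms] by simp
  with dom_rho obtain zs N where zs: "\<rho> H = Some (zs, N)" by (metis domD surj_pair)
  note b = wf_bodiesD[OF wf_rho zs]
  have l: "length zs = length ys" and d: "distinct ys"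
    using eq_Meta_vars[OF assms] b vars_of_types_length by metis+
  have "(rename ys zs N, M) \<in> eqs \<Delta>"
    using rho_eqs[OF zs]
  proof (elim conjE disjE)
    assume "(Meta [] H zs, N) \<in> eqs \<Delta>"
    with assms show ?thesis by (rule eq_agree) (rule b(3))
  next
    \<comment> \<open>The identity equation of a representative may be absent from \<Delta>, but
      then the replacement changes nothing.\<close>
    assume "N = Meta [] H zs"
    then have "rename ys zs N = Meta [] H ys"
      using map_renaming[of zs ys] b(4) l by (simp add: rename_eq lift_0)
    with assms show ?thesis by simp
  qed
  moreover have "replace \<rho> (Meta [] H ys) = rename ys zs N"
    using zs b(6) set_binders_binders[of "rename ys zs N"] by (simp add: rename_eq)
  ultimately show thesis using that zs l by blast
qed

section \<open>Reducing the sides of equations of \<Delta>\<close>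

definition nargs :: "('b, 'c) trm \<Rightarrow> nat" where
  "nargs M = (case M of Meta Ts H ys \<Rightarrow> length ys | _ \<Rightarrow> 0)"

text \<open>Only the top of the term counts. Metavariables in arguments are met at the next smaller
  depth.\<close>

definition reduced :: "('b, 'c) trm \<Rightarrow> bool" where
  "reduced M \<longleftrightarrow> (\<forall>Ts H ys. M = Meta Ts H ys \<longrightarrow> H \<in> R)"

text \<open>The result is an iterate of \<open>replace \<rho>\<close> so that its \<gamma>-instance
  is that of \<open>M\<close> (\<open>replace_gamma_iter\<close>).\<close>

lemma reduce:
  assumes "(M, M') \<in> eqs \<Delta>" "binders M = []"
  shows "\<exists>i. ((replace \<rho> ^^ i) M, M') \<in> eqs \<Delta> \<and> binders ((replace \<rho> ^^ i) M) = [] \<and>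
    reduced ((replace \<rho> ^^ i) M)"
  using assms
proof (induction "nargs M" arbitrary: M rule: less_induct)
  case less
  show ?case
  proof (cases "\<exists>H ys. M = Meta [] H ys")
    case False
    with less.prems have "reduced M" by (auto simp: reduced_def)
    with less.prems show ?thesis by (intro exI[of _ 0]) simp
  next
    case True
    then obtain H ys where M: "M = Meta [] H ys" by blast
    obtain zs N where zs: "\<rho> H = Some (zs, N)" "replace \<rho> M = rename ys zs N"
      "(rename ys zs N, M') \<in> eqs \<Delta>" "length zs = length ys"
      using replace_rho_eq less.prems(1) unfolding M by blast
    note b = wf_bodiesD[OF wf_rho zs(1)]
    have bN: "binders (rename ys zs N) = []" using b(6) by (simp add: rename_eq)
    have finish: ?thesis if "reduced (rename ys zs N)"
      using that zs bN by (intro exI[of _ 1]) simp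
    show ?thesis
      using zs(1)
    proof (cases rule: rho_cases)
      case (rep G xs)
      then show ?thesis by (intro finish) (simp add: reduced_def rename_eq)
    next
      case eq
      show ?thesis
      proof (cases "\<exists>G ws. N = Meta [] G ws")
        case False
        with b(6) have "reduced (rename ys zs N)"
          by (cases N) (auto simp: reduced_def rename_eq)
        then show ?thesis by (rule finish)
      next
        case True
        then obtain G ws where N: "N = Meta [] G ws" by blast
        with eq(3) have "set ws \<subset> set zs"
          unfolding resolution_def by (auto split: tag.splits)
        \<comment> \<open>Both lists are distinct, so the proper inclusion of their sets makes the
          new argument list shorter.\<close>
        then have "card (set ws) < card (set zs)" by (intro psubset_card_mono) auto
        moreover have "distinct ws" using wt_MetaD(5) b(2) N by blast
        ultimately have "length ws < length zs"
          using b(4) by (simp add: distinct_card)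
        then have "nargs (rename ys zs N) < nargs M"
          using zs(4) by (simp add: nargs_def M N rename_eq)
        from less.hyps[OF this zs(3) bN] obtain i where
          "((replace \<rho> ^^ i) (replace \<rho> M), M') \<in> eqs \<Delta> \<and>
            binders ((replace \<rho> ^^ i) (replace \<rho> M)) = [] \<and>
            reduced ((replace \<rho> ^^ i) (replace \<rho> M))"
          unfolding zs(2) by blast
        then show ?thesis by (intro exI[of _ "Suc i"]) (simp only: funpow_Suc_right o_apply)
      qed
    qed
  qed
qed

text \<open>After \<open>n\<close> rounds on the bodies, applying the map is itself one further
  replacement; hence \<open>Suc n\<close>. Well-formedness is carried along because the inductive
  step composes with the previous map.\<close>

lemma map_bodies_iter:
  "wf_bodies sig (map_bodies (replace \<rho> ^^ n) \<rho>) \<and>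
    (wt sig E m M T \<longrightarrow> replace (map_bodies (replace \<rho> ^^ n) \<rho>) M = (replace \<rho> ^^ Suc n) M)"
proof (induction n arbitrary: E m M T)
  case 0
  have *: "map_bodies (replace \<rho> ^^ 0) \<rho> = \<rho>"
    by (simp add: fun_eq_iff map_bodies_def option.map_id)
  show ?case unfolding * using wf_rho by simp
next
  case (Suc n)
  let ?\<sigma> = "map_bodies (replace \<rho> ^^ n) \<rho>"
  have *: "map_bodies (replace \<rho> ^^ Suc n) \<rho> = map_bodies (replace \<rho>) ?\<sigma>"
    by (simp add: fun_eq_iff map_bodies_def option.map_comp comp_def case_prod_unfold)
  have "replace (map_bodies (replace \<rho>) ?\<sigma>) M = (replace \<rho> ^^ Suc (Suc n)) M"
    if "wt sig E m M T"
  proof -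
    have "replace (map_bodies (replace \<rho>) ?\<sigma>) M = replace \<rho> (replace ?\<sigma> M)"
      using Suc.IH[THEN conjunct1]
      by (rule replace_map_bodies[OF _ wf_rho that]) (simp add: map_bodies_def)
    with Suc.IH that show ?thesis by simp
  qed
  with Suc show ?case
    unfolding * using wf_map_bodies[OF _ wf_rho] by blast
qed

end

section \<open>The substitution that the construction yields\<close>

locale unified = chosen sig \<Delta> \<rho> R
  for sig :: "'c \<Rightarrow> 'b ty" and \<Delta> :: "('b, 'c) ctx" and \<rho> :: "('b, 'c) bodies"
    and R :: "'b mvar set" +
  fixes n :: nat and \<Gamma> :: "('b, 'c) ctx"
  assumes \<Gamma>: "\<Gamma> = (replace_round \<rho> ^^ n) (unif_start \<Delta> \<rho>)"
    and reps: "\<forall>(L, M)\<in>eqs \<Gamma>. mvs M \<subseteq> R"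
    and def_reps: "\<forall>U\<in>ran (defs \<Gamma>). mvs U \<subseteq> R"
begin

text \<open>The map belonging to \<Gamma> (\<open>lookup_Gamma\<close>), in a form open to induction
  on the number of rounds.\<close>

abbreviation "\<gamma> \<equiv> map_bodies (replace \<rho> ^^ n) \<rho>"

lemma wf_gamma: "wf_bodies sig \<gamma>"
  using map_bodies_iter by blast

lemma replace_gamma: "wt sig E m M T \<Longrightarrow> replace \<gamma> M = (replace \<rho> ^^ Suc n) M"
  using map_bodies_iter by blast

lemma round_iter:
  "eqs ((replace_round \<rho> ^^ i) (unif_start \<Delta> \<rho>))
     = {(Meta [] H zs, (replace \<rho> ^^ i) M) |H zs M. \<rho> H = Some (zs, M)} \<and>
   defs ((replace_round \<rho> ^^ i) (unif_start \<Delta> \<rho>)) = (\<lambda>r. map_option (replace \<rho> ^^ i) (defs \<Delta> r)) \<and>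
   \<not> contra ((replace_round \<rho> ^^ i) (unif_start \<Delta> \<rho>))"
proof (induction i)
  case 0
  show ?case by (simp add: unif_start_def option.map_ident)
next
  case (Suc i)
  then show ?case
    by (auto simp: replace_round_def option.map_comp comp_def)
qed

lemma eqs_Gamma: "(L, M) \<in> eqs \<Gamma> \<longleftrightarrow> (\<exists>H zs. L = Meta [] H zs \<and> \<gamma> H = Some (zs, M))"
  using round_iter[of n] by (auto simp: \<Gamma> map_bodies_Some)

lemma gamma_reps: "\<gamma> H = Some (zs, M) \<Longrightarrow> mvs M \<subseteq> R"
  using reps eqs_Gamma by blast

lemma dom_gamma: "dom \<gamma> = UV \<Delta>"
  using dom_rho by (auto simp: map_bodies_def dom_def)

text \<open>On terms \<gamma> is a power of \<rho>, so the left side is also \<rho> applied to the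
  \<gamma>-instance of \<open>M\<close>. The only metavariables of \<Delta> left in that instance
  are representatives, which \<rho> fixes.\<close>

lemma replace_gamma_rho:
  assumes "wt sig E m M T"
  shows "replace \<gamma> (replace \<rho> M) = replace \<gamma> M"
proof -
  have "mvs (replace \<gamma> M) \<inter> UV \<Delta> \<subseteq> R"
  proof
    fix G assume G: "G \<in> mvs (replace \<gamma> M) \<inter> UV \<Delta>"
    then obtain H where H: "G \<in> (case \<gamma> H of Some (zs, N) \<Rightarrow> mvs N | None \<Rightarrow> {H})"
      unfolding mvs_replace by blast
    show "G \<in> R"
    proof (cases "\<gamma> H")
      case None
      with H have "G \<notin> dom \<gamma>" by auto
      with G dom_gamma show ?thesis by simp
    next
      case (Some p)
      with H gamma_reps[of H "fst p" "snd p"] show ?thesis by (auto split: prod.splits)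
    qed
  qed
  from rho_replace_fixed[OF wt_replace[OF wf_gamma assms] this]
  have "replace \<rho> (replace \<gamma> M) = replace \<gamma> M" .
  then show ?thesis
    using replace_gamma[OF assms] replace_gamma[OF wt_replace[OF wf_rho assms]]
    by (metis funpow_swap1)
qed

lemma replace_gamma_iter:
  assumes "wt sig E m M T"
  shows "replace \<gamma> ((replace \<rho> ^^ i) M) = replace \<gamma> M"
  by (induction i) (simp_all add: replace_gamma_rho[OF wt_rho_iter[OF assms]])

text \<open>Definition bodies pass through only \<open>n\<close> replacements, while \<gamma>
  amounts to \<open>Suc n\<close>. The extra one is harmless: after \<open>n\<close> rounds only
  representatives remain.\<close>

lemma defs_Gamma: "defs \<Gamma> r = map_option (replace \<gamma>) (defs \<Delta> r)"
proof (cases "defs \<Delta> r")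
  case (Some U)
  have w: "wt sig [] Con U (rty r)"
    using Some wf_ctx_defs[OF wf] by (auto simp: wf_defs_def)
  have d: "defs \<Gamma> r = Some ((replace \<rho> ^^ n) U)"
    using round_iter[of n] Some by (simp add: \<Gamma>)
  then have "mvs ((replace \<rho> ^^ n) U) \<subseteq> R"
    using def_reps by (auto intro: ranI)
  then have "mvs ((replace \<rho> ^^ n) U) \<inter> UV \<Delta> \<subseteq> R" by blast
  from rho_replace_fixed[OF wt_rho_iter[OF w] this]
  have "replace \<gamma> U = (replace \<rho> ^^ n) U"
    by (simp add: replace_gamma[OF w])
  with d Some show ?thesis by simp
qed (use round_iter[of n] in \<open>simp add: \<Gamma>\<close>)

lemma lookup_Gamma: "lookup \<Gamma> = \<gamma>"
proof
  fix H
  show "lookup \<Gamma> H = \<gamma> H"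
  proof (cases "\<gamma> H")
    case None
    then have "H \<notin> sdom \<Gamma>" by (auto simp: sdom_def eqs_Gamma)
    with None show ?thesis by (simp add: lookup_None)
  next
    case (Some p)
    obtain zs M where p: "p = (zs, M)" by (cases p)
    have "lookup \<Gamma> H = Some (zs, M)"
      by (rule lookup_eqI) (use Some p in \<open>auto simp: eqs_Gamma\<close>)
    with Some p show ?thesis by simp
  qed
qed

lemma subst_Gamma: "subst \<Gamma> = replace \<gamma>"
  by (simp add: fun_eq_iff subst_def lookup_Gamma)

lemma sdom_Gamma: "sdom \<Gamma> = UV \<Delta>"
  using dom_lookup[of \<Gamma>] by (simp add: lookup_Gamma dom_gamma)

lemma dom_defs_Gamma: "dom (defs \<Gamma>) = dom (defs \<Delta>)"
  by (auto simp: defs_Gamma dom_def)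

lemma rcs_rho_iter: "rcs M \<subseteq> dom (defs \<Delta>) \<Longrightarrow> rcs ((replace \<rho> ^^ i) M) \<subseteq> dom (defs \<Delta>)"
proof (induction i)
  case (Suc i)
  have "rcs N \<subseteq> dom (defs \<Delta>)" if "\<rho> H = Some (zs, N)" for H zs N
    using rho_eqs[OF that] rcs_eqs[OF wf, of "Meta [] H zs" N] by auto
  then have "rcs (replace \<rho> ((replace \<rho> ^^ i) M)) \<subseteq> rcs ((replace \<rho> ^^ i) M) \<union> dom (defs \<Delta>)"
    by (rule rcs_replace)
  with Suc show ?case by auto
qed simp

lemma wf_ctx_Gamma: "wf_ctx sig \<Gamma>"
proof -
  have "eqs \<Gamma> \<subseteq> (\<lambda>H. (Meta [] H (fst (the (\<gamma> H))), snd (the (\<gamma> H)))) ` UV \<Delta>"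
  proof
    fix e assume "e \<in> eqs \<Gamma>"
    then obtain H zs M where "e = (Meta [] H zs, M)" "\<gamma> H = Some (zs, M)"
      using eqs_Gamma by (cases e) auto
    then show "e \<in> (\<lambda>H. (Meta [] H (fst (the (\<gamma> H))), snd (the (\<gamma> H)))) ` UV \<Delta>"
      using dom_gamma by (intro image_eqI[of _ _ H]) auto
  qed
  then have "finite (eqs \<Gamma>)" by (rule finite_surj[OF finite_UV])
  moreover have "finite (dom (defs \<Gamma>))"
    using wf by (simp add: dom_defs_Gamma wf_ctx_def)
  moreover have "\<exists>m T. wt sig [] m L T \<and> wt sig [] m M T" if "(L, M) \<in> eqs \<Gamma>" for L M
  proof -
    from that obtain H zs where L: "L = Meta [] H zs" and H: "\<gamma> H = Some (zs, M)"
      by (auto simp: eqs_Gamma)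
    note b = wf_bodiesD[OF wf_gamma H]
    from wt_MetaI[of "[]" "[]" zs H sig] b(1,2) L show ?thesis by auto
  qed
  moreover have "wt sig [] Con U (rty r) \<and> fv U = {}" if "defs \<Gamma> r = Some U" for r U
  proof -
    from that obtain V where V: "defs \<Delta> r = Some V" "U = replace \<gamma> V"
      by (auto simp: defs_Gamma)
    then have w: "wt sig [] Con V (rty r)" "fv V = {}"
      using wf_ctx_defs[OF wf] by (auto simp: wf_defs_def)
    from wt_replace[OF wf_gamma w(1)] fv_replace[OF wf_gamma w(1)] w(2) V(2)
    show ?thesis by simp
  qed
  moreover have "ctx_rcs \<Gamma> \<subseteq> dom (defs \<Gamma>)"
  proof -
    have "rcs L \<union> rcs M \<subseteq> dom (defs \<Delta>)" if e: "(L, M) \<in> eqs \<Gamma>" for L M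
    proof -
      from e obtain H zs N where "L = Meta [] H zs" and H: "\<rho> H = Some (zs, N)"
        and "M = (replace \<rho> ^^ n) N"
        by (auto simp: eqs_Gamma map_bodies_Some)
      moreover have "rcs N \<subseteq> dom (defs \<Delta>)"
        using rho_eqs[OF H] rcs_eqs[OF wf, of "Meta [] H zs" N] by auto
      ultimately show ?thesis using rcs_rho_iter by simp
    qed
    moreover have "rcs U \<subseteq> dom (defs \<Delta>)" if "U \<in> ran (defs \<Gamma>)" for U
    proof -
      from that obtain r where "defs \<Gamma> r = Some U" by (auto simp: ran_def)
      then obtain V where V: "defs \<Delta> r = Some V" "U = replace \<gamma> V"
        by (auto simp: defs_Gamma)
      then have w: "wt sig [] Con V (rty r)"
        using wf_ctx_defs[OF wf] by (auto simp: wf_defs_def)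
      show ?thesis
        unfolding V(2) replace_gamma[OF w] by (rule rcs_rho_iter[OF rcs_defs[OF wf V(1)]])
    qed
    ultimately show ?thesis
      unfolding ctx_rcs_def dom_defs_Gamma by blast
  qed
  ultimately show ?thesis
    unfolding wf_ctx_def by auto
qed

lemma is_subst_Gamma: "is_subst sig \<Gamma>"
proof -
  have "\<not> contra \<Gamma>" using round_iter[of n] by (simp add: \<Gamma>)
  moreover have "\<exists>H xs. L = Meta [] H xs \<and> fv M \<subseteq> set xs \<and> binders M = []"
    if "(L, M) \<in> eqs \<Gamma>" for L M
    using that wf_bodiesD(3,6)[OF wf_gamma] by (auto simp: eqs_Gamma)
  ultimately show ?thesis
    unfolding is_subst_def using wf_ctx_Gamma by (auto simp: eqs_Gamma)
qed

lemma wf_defs_Gamma: "wf_defs sig (defs \<Gamma>)"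
  by (rule wf_ctx_defs[OF wf_ctx_Gamma])


subsection \<open>The unification property\<close>

text \<open>Expansions are taken in \<Gamma> and not in \<open>subst_ctx \<Delta> \<Gamma>\<close>,
  so that each recursion constant has one copy, defined by the \<gamma>-instance of its body in
  \<Delta>.\<close>

definition agree_upto :: "nat \<Rightarrow> bool" where
  "agree_upto k \<longleftrightarrow> (\<forall>(M, M')\<in>eqs \<Delta>. expand \<Gamma> k (replace \<gamma> M) = expand \<Gamma> k (replace \<gamma> M'))"

text \<open>The left side is reduced first, then the right side through symmetry. The typing clause
  records that a contractive side stays contractive, which \<open>expand_reduced\<close> needs after
  unfolding.\<close>

lemma eq_reduce:
  assumes "(M, M') \<in> eqs \<Delta>" "binders M = []" "binders M' = []"
  obtains N N' where "(N, N') \<in> eqs \<Delta>" "binders N = []" "binders N' = []" "reduced N" "reduced N'"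
    "replace \<gamma> N = replace \<gamma> M" "replace \<gamma> N' = replace \<gamma> M'"
    "\<And>m T. wt sig [] m M T \<Longrightarrow> wt sig [] m N T"
proof -
  from reduce[OF assms(1,2)] obtain i where
    i: "((replace \<rho> ^^ i) M, M') \<in> eqs \<Delta>" "binders ((replace \<rho> ^^ i) M) = []"
      "reduced ((replace \<rho> ^^ i) M)" by blast
  from reduce[OF eq_sym[OF i(1)] assms(3)] obtain j where
    j: "((replace \<rho> ^^ j) M', (replace \<rho> ^^ i) M) \<in> eqs \<Delta>" "binders ((replace \<rho> ^^ j) M') = []"
      "reduced ((replace \<rho> ^^ j) M')" by blast
  have "replace \<gamma> ((replace \<rho> ^^ i) M) = replace \<gamma> M"
    by (rule wf_ctx_wt[OF wf assms(1)]) (rule replace_gamma_iter)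
  moreover have "replace \<gamma> ((replace \<rho> ^^ j) M') = replace \<gamma> M'"
    by (rule wf_ctx_wt[OF wf assms(1)]) (rule replace_gamma_iter)
  ultimately show thesis
    using that[OF eq_sym[OF j(1)] i(2) j(2) i(3) j(3)] wt_rho_iter by blast
qed

lemma reduced_Metas:
  assumes "(Meta [] G xs, Meta [] H ys) \<in> eqs \<Delta>" "G \<in> R" "H \<in> R"
  shows "Meta [] G xs = Meta [] H ys"
  using reps_eq[OF assms(2,3,1)] unresolved_same_args assms R_not_resolved by blast

text \<open>Kept apart from the case of a recursion constant on the left, because unfolding there
  leads back to this lemma at the same depth \<open>Suc k\<close>, whereas
  \<open>agree_upto k\<close> covers only arguments.\<close>

lemma expand_reduced_nonrec:
  assumes IH: "agree_upto k" and e: "(N, N') \<in> eqs \<Delta>" and b: "binders N = []" "binders N' = []"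
    and red: "reduced N" "reduced N'" and nonrec: "\<And>Ts r xs. N \<noteq> Rec Ts r xs"
  shows "expand \<Gamma> (Suc k) (replace \<gamma> N) = expand \<Gamma> (Suc k) (replace \<gamma> N')"
proof (cases N)
  case (App Ts h Ns)
  with b have N: "N = App [] h Ns" by simp
  show ?thesis
  proof (cases N')
    case (App Ts' h' Ns')
    with b have N': "N' = App [] h' Ns'" by simp
    have h: "h' = h" using head_eq e unfolding N N' by blast
    have len: "length Ns = length Ns'" using args_length e unfolding N N' h by blast
    have "expand \<Gamma> k (replace \<gamma> (Ns ! i)) = expand \<Gamma> k (replace \<gamma> (Ns' ! i))" if "i < length Ns" for i
      using args_eq[OF e[unfolded N N' h] that] IH unfolding agree_upto_def by blast
    then show ?thesis
      using len by (simp add: N N' h list_eq_iff_nth_eq)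
  next
    case (Meta Ts' H ys)
    with b have N': "N' = Meta [] H ys" by simp
    with red have "H \<in> R" by (simp add: reduced_def)
    with resolved_App[OF eq_sym[OF e[unfolded N N']]] R_not_resolved show ?thesis by blast
  next
    case (Rec Ts' r xs)
    with eq_App_Rec e N show ?thesis by blast
  qed
next
  case (Meta Ts H ys)
  with b have N: "N = Meta [] H ys" by simp
  with red have H: "H \<in> R" by (simp add: reduced_def)
  show ?thesis
  proof (cases N')
    case (App Ts' h Ns)
    with b have N': "N' = App [] h Ns" by simp
    from resolved_App[OF e[unfolded N N']] H R_not_resolved show ?thesis by blast
  next
    case (Meta Ts' G xs)
    with b have N': "N' = Meta [] G xs" by simp
    with red have "G \<in> R" by (simp add: reduced_def)
    with reduced_Metas[OF e[unfolded N N'] H] N N' show ?thesis by simp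
  next
    case (Rec Ts' r xs)
    with b have N': "N' = Rec [] r xs" by simp
    from resolved_Rec[OF e[unfolded N N']] H R_not_resolved show ?thesis by blast
  qed
next
  case (Rec Ts r xs)
  with nonrec show ?thesis by blast
qed

text \<open>\<Gamma> defines \<open>r\<close> by the \<gamma>-instance of \<open>U\<close>, and
  replacement commutes with instantiation. The disjunction lets the lemma serve either side of an
  equation.\<close>

lemma expand_gamma_Rec:
  assumes "(Rec [] r xs, M) \<in> eqs \<Delta> \<or> (M, Rec [] r xs) \<in> eqs \<Delta>" "defs \<Delta> r = Some U"
  shows "expand \<Gamma> k (replace \<gamma> (Rec [] r xs)) = expand \<Gamma> k (replace \<gamma> (instantiate U xs))"
    and "\<exists>T. wt sig [] Con (instantiate U xs) T"
proof -
  obtain m T where w: "wt sig [] m (Rec [] r xs) T"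
    using assms(1) wf_ctx_wt[OF wf] by metis
  note u = wf_defsD[OF wf_ctx_defs[OF wf] assms(2)]
  have "defs \<Gamma> r = Some (replace \<gamma> U)" using assms(2) by (simp add: defs_Gamma)
  from expand_Rec[OF wf_defs_Gamma w this]
  have "expand \<Gamma> k (Rec [] r xs) = expand \<Gamma> k (set_binders [] (instantiate (replace \<gamma> U) xs))" .
  moreover have "set_binders [] (instantiate (replace \<gamma> U) xs) = instantiate (replace \<gamma> U) xs"
    using set_binders_binders[of "instantiate (replace \<gamma> U) xs"] by simp
  ultimately show "expand \<Gamma> k (replace \<gamma> (Rec [] r xs)) = expand \<Gamma> k (replace \<gamma> (instantiate U xs))"
    by (simp only: replace.simps replace_instantiate[OF wf_gamma u(1)])
  have "vars_of_types [] xs (doms (rty r))" using wt_RecD(3)[OF w] by simp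
  from wt_instantiate[OF u this] show "\<exists>T. wt sig [] Con (instantiate U xs) T" by blast
qed

lemma expand_reduced:
  assumes IH: "agree_upto k" and e: "(N, N') \<in> eqs \<Delta>" and b: "binders N = []" "binders N' = []"
    and red: "reduced N" "reduced N'"
  shows "expand \<Gamma> (Suc k) (replace \<gamma> N) = expand \<Gamma> (Suc k) (replace \<gamma> N')"
proof (cases "\<exists>r xs. N = Rec [] r xs")
  case False
  with b(1) have "\<And>Ts r xs. N \<noteq> Rec Ts r xs" by auto
  with expand_reduced_nonrec[OF IH e b red] show ?thesis by blast
next
  case True
  then obtain r xs where N: "N = Rec [] r xs" by blast
  show ?thesis
  proof (cases N')
    case (App Ts h Ns)
    with eq_App_Rec eq_sym[OF e] N show ?thesis by blast
  next
    case (Meta Ts H ys)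
    with b have N': "N' = Meta [] H ys" by simp
    with red have "H \<in> R" by (simp add: reduced_def)
    with resolved_Rec[OF eq_sym[OF e[unfolded N N']]] R_not_resolved show ?thesis by blast
  next
    case (Rec Ts s ys)
    with b have N': "N' = Rec [] s ys" by simp
    note e' = e[unfolded N N']
    obtain U V where U: "defs \<Delta> r = Some U" and V: "defs \<Delta> s = Some V"
      and uv: "(instantiate U xs, instantiate V ys) \<in> eqs \<Delta>"
      by (rule eq_Rec_unfold[OF e'])
    from expand_gamma_Rec[OF disjI1[OF e'] U] obtain T where
      wU: "wt sig [] Con (instantiate U xs) T" and
      eU: "\<And>k. expand \<Gamma> k (replace \<gamma> N) = expand \<Gamma> k (replace \<gamma> (instantiate U xs))"
      unfolding N by blast
    have eV: "expand \<Gamma> k (replace \<gamma> N') = expand \<Gamma> k (replace \<gamma> (instantiate V ys))" for k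
      unfolding N' by (rule expand_gamma_Rec[OF disjI2[OF e'] V])
    \<comment> \<open>The unfolded bodies may start with a metavariable that is no representative,
      so they are reduced once more. \<open>P\<close> is contractive and therefore no recursion
      constant, which ends the unfolding.\<close>
    obtain P P' where P: "(P, P') \<in> eqs \<Delta>" "binders P = []" "binders P' = []"
      "reduced P" "reduced P'" "replace \<gamma> P = replace \<gamma> (instantiate U xs)"
      "replace \<gamma> P' = replace \<gamma> (instantiate V ys)" "wt sig [] Con P T"
      by (rule eq_reduce[OF uv]) (use wU in auto)
    have "P \<noteq> Rec Ts t zs" for Ts t zs
      using wt_RecD(1) P(8) by blast
    from expand_reduced_nonrec[OF IH P(1-5) this] show ?thesis
      by (simp only: eU eV P(6,7))
  qed
qed

lemma expand_no_binders:
  assumes "agree_upto k" "(M, M') \<in> eqs \<Delta>" "binders M = []" "binders M' = []"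
  shows "expand \<Gamma> (Suc k) (replace \<gamma> M) = expand \<Gamma> (Suc k) (replace \<gamma> M')"
  by (rule eq_reduce[OF assms(2-4)]) (metis expand_reduced[OF assms(1)])

text \<open>\<open>g\<close> sends the fresh variable \<open>xs ! i\<close> back to index
  \<open>i\<close>; freshness keeps it away from the free variables of \<open>M\<close>. It depends
  on \<open>xs\<close> only, so one \<open>g\<close> recovers both sides of an equation opened by
  U-INST or N-INST.\<close>

lemma abstract:
  assumes "wt sig [] m M T" "vars_of_types [] xs (binders M)" "set xs \<inter> fv M = {}"
    and g: "g = (\<lambda>v. case v of
      Free k S \<Rightarrow> (case map_of (zip xs (map Bound [0..<length xs])) v of Some w \<Rightarrow> w | None \<Rightarrow> v)
      | Bound i \<Rightarrow> Bound i)"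
  shows "M = set_binders (binders M) (ren g (instantiate M xs))"
proof -
  obtain b where "T = Ty (binders M) b" using wt_Ty[OF assms(1)] by blast
  with assms(1) have w: "wt sig (binders M) m (set_binders [] M) (Ty [] b)"
    using wt_drop_binders[of sig "[]"] by simp
  have l: "length xs = length (binders M)" "distinct xs"
    using assms(2) vars_of_types_length vars_of_types_distinct by metis+
  have "(g \<circ> inst_var xs) v = v" if v: "v \<in> scope (fv M) (length (binders M))" for v
  proof (cases v)
    case (Free k S)
    with v assms(3) have "v \<notin> set xs" by (auto simp: scope_def frees_def)
    then have *: "map_of (zip xs (map Bound [0..<length xs])) (Free k S) = (None :: 'b var option)"
      using Free by (simp add: map_of_zip_is_None)
    have "inst_var xs v = v" using Free by (simp add: inst_var_def)
    then show ?thesis by (simp add: g Free *)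
  next
    case (Bound i)
    with v have i: "i < length xs" by (auto simp: scope_def frees_def l)
    then obtain k S where "xs ! i = Free k S"
      using vars_of_types_Free[OF assms(2), of "xs ! i"] by auto
    moreover have "map_of (zip xs (map Bound [0..<length xs])) (xs ! i) = Some (Bound i :: 'b var)"
      using i l(2) by (subst map_of_zip_nth) auto
    ultimately show ?thesis using i Bound by (simp add: g inst_var_def)
  qed
  then have "ren (g \<circ> inst_var xs) (set_binders [] M) = ren (\<lambda>v. v) (set_binders [] M)"
    by (intro ren_cong[OF w, of "fv M"]) auto
  then show ?thesis
    by (simp add: instantiate_eq ren_ren ren_id)
qed

lemma agree_all: "agree_upto k"
proof (induction k)
  case (Suc k)
  show ?case
    unfolding agree_upto_def
  proof (clarify)
    fix M M' assume e: "(M, M') \<in> eqs \<Delta>"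
    obtain m T where w: "wt sig [] m M T" "wt sig [] m M' T" by (rule wf_ctx_wt[OF wf e])
    have bb: "binders M' = binders M" using wt_Ty[OF w(1)] wt_Ty[OF w(2)] by auto
    obtain xs where xs: "(instantiate M xs, instantiate M' xs) \<in> eqs \<Delta>"
      "vars_of_types [] xs (binders M)" "set xs \<inter> (fv M \<union> fv M') = {}"
      by (rule eq_instantiate[OF e])
    define g where "g = (\<lambda>v. case v of Free k S \<Rightarrow>
        (case map_of (zip xs (map Bound [0..<length xs])) v of Some w \<Rightarrow> w | None \<Rightarrow> v)
      | Bound i \<Rightarrow> (Bound i :: 'b var))"
    \<comment> \<open>The expansion of a side is obtained from that of its opened form by restoring
      the binders, at the same depth. So agreement of the opened sides carries over.\<close>
    have *: "expand \<Gamma> (Suc k) (replace \<gamma> N) = eset_binders (binders N)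
        (eren g (expand \<Gamma> (Suc k) (replace \<gamma> (instantiate N xs))))"
      if N: "N = set_binders (binders N) (ren g (instantiate N xs))"
        and w: "wt sig [] m' (instantiate N xs) T'" for N m' T'
    proof -
      have "replace \<gamma> N = replace \<gamma> (set_binders (binders N) (ren g (instantiate N xs)))"
        using N by (rule arg_cong)
      also have "\<dots> = set_binders (binders N) (ren g (replace \<gamma> (instantiate N xs)))"
        by (simp only: replace_set_binders replace_ren[OF wf_gamma w])
      finally show ?thesis
        by (simp only: expand_set_binders expand_ren[OF wf_defs_Gamma wt_replace[OF wf_gamma w]])
    qed
    obtain m' T' where w': "wt sig [] m' (instantiate M xs) T'" "wt sig [] m' (instantiate M' xs) T'"
      by (rule wf_ctx_wt[OF wf xs(1)])
    have "M = set_binders (binders M) (ren g (instantiate M xs))"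
      by (rule abstract[OF w(1) xs(2) _ g_def]) (use xs(3) in blast)
    moreover have "M' = set_binders (binders M') (ren g (instantiate M' xs))"
      by (rule abstract[OF w(2) _ _ g_def]) (use xs(2,3) bb in auto)
    ultimately show "expand \<Gamma> (Suc k) (replace \<gamma> M) = expand \<Gamma> (Suc k) (replace \<gamma> M')"
      using expand_no_binders[OF Suc xs(1)] * w' bb by (simp del: expand.simps)
  qed
qed (simp add: agree_upto_def)

lemma unifier_Gamma: "unifier sig \<Delta> \<Gamma>"
proof -
  have "expand (subst_ctx \<Delta> \<Gamma>) k (subst (rename_apart \<Delta> \<Gamma>) M) =
      expand (subst_ctx \<Delta> \<Gamma>) k (subst (rename_apart \<Delta> \<Gamma>) M')" if "(M, M') \<in> eqs \<Delta>" for M M' k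
  proof -
    have "rcs M \<subseteq> dom (defs \<Delta>)" "rcs M' \<subseteq> dom (defs \<Delta>)" using rcs_eqs[OF wf that] by auto
    moreover have "defs \<Gamma> r = map_option (subst \<Gamma>) (defs \<Delta> r)" for r
      by (simp add: defs_Gamma subst_Gamma)
    ultimately show ?thesis
      using agree_all[of k] that expand_subst_ctx_lower[OF wf is_subst_Gamma]
      by (simp add: agree_upto_def subst_Gamma) blast
  qed
  then show ?thesis
    using no_contra is_subst_Gamma sdom_Gamma
    by (auto simp: unifier_def holds_in_def subst_ctx_def Let_def)
qed


section \<open>Every unifier factors through the constructed substitution\<close>

lemma more_general_Gamma:
  assumes "unifier sig \<Delta> \<Theta>"
  shows "more_general sig \<Gamma> \<Theta>"
proof -
  have sub: "is_subst sig \<Theta>" and dom: "sdom \<Theta> = UV \<Delta>"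
    and holds: "\<And>M M'. (M, M') \<in> eqs (subst_ctx \<Delta> \<Theta>) \<Longrightarrow> holds_in (subst_ctx \<Delta> \<Theta>) M M'"
    using assms by (auto simp: unifier_def)
  let ?g = "raise (fresh \<Delta>)" and ?D1 = "subst_ctx \<Delta> \<Theta>" and ?D2 = "compose \<Gamma> \<Theta>"
  define \<theta> where "\<theta> = map_bodies (map_rcs ?g) (lookup \<Theta>)"
  have apart: "rename_apart \<Gamma> \<Theta> = rename_apart \<Delta> \<Theta>"
    by (rule rename_apart_cong) (rule dom_defs_Gamma)
  have subst: "subst (rename_apart \<Delta> \<Theta>) = replace \<theta>"
    by (simp add: fun_eq_iff subst_def \<theta>_def lookup_rename_apart[OF sub])
  have wf\<theta>: "wf_bodies sig \<theta>"
    unfolding \<theta>_def by (rule wf_bodies_map_rcs[OF wf_bodies_lookup[OF sub]])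
  have dom\<theta>: "dom \<theta> = UV \<Delta>"
    using dom dom_lookup[of \<Theta>] by (auto simp: \<theta>_def map_bodies_def dom_def)
  have wf1: "wf_defs sig (defs ?D1)" by (rule wf_defs_subst_ctx[OF wf sub])
  have wf2: "wf_defs sig (defs ?D2)"
    unfolding defs_compose by (rule wf_defs_subst_ctx[OF wf_ctx_Gamma sub])
  have eqn: "holds_in ?D1 (replace \<theta> M) (replace \<theta> M')" if "(M, M') \<in> eqs \<Delta>" for M M'
    using that by (intro holds) (auto simp: subst_ctx_def Let_def subst)
  \<comment> \<open>Chosen equations from \<Delta> hold because \<Theta> is a unifier; the identity
    equations of representatives hold trivially.\<close>
  have \<rho>: "holds_in ?D1 (replace \<theta> (Meta [] H zs)) (replace \<theta> M)" if "\<rho> H = Some (zs, M)" for H zs M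
    using rho_eqs[OF that] eqn[of "Meta [] H zs" M] unfolding holds_in_def by blast
  have iter: "expand ?D1 k (replace \<theta> ((replace \<rho> ^^ i) M)) = expand ?D1 k (replace \<theta> M)"
    if "wt sig E m M T" for E m M T k i
  proof (induction i)
    case (Suc i)
    with expand_replace_cong[OF wf1 wf_rho wf\<theta> \<rho> wt_rho_iter[OF that]] show ?case by simp
  qed simp
  have \<gamma>: "expand ?D1 k (replace \<theta> (replace \<gamma> M)) = expand ?D1 k (replace \<theta> M)"
    if "wt sig E m M T" for E m M T k
    unfolding replace_gamma[OF that] by (rule iter[OF that])
  \<comment> \<open>For constants defined in \<Delta> the two contexts differ only by a
    \<gamma>-instance in the body, which \<open>?D1\<close> cannot see; all other definitions
    coincide.\<close>
  have D12: "expand ?D1 k M = expand ?D2 k M" if "wt sig E m M T" for E m M T k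
  proof (rule expand_defs_cong[OF wf1 wf2 _ _ that])
    show "dom (defs ?D1) = dom (defs ?D2)"
      by (auto simp: defs_compose subst_ctx_def Let_def apart defs_Gamma dom_def map_add_def
          split: option.splits)
  next
    fix r U1 U2 assume U1: "defs ?D1 r = Some U1" and U2: "defs ?D2 r = Some U2"
    show "holds_in ?D1 U1 U2"
    proof (cases "defs \<Delta> r")
      case (Some U)
      then have w: "wt sig [] Con U (rty r)"
        using wf_ctx_defs[OF wf] by (auto simp: wf_defs_def)
      have "defs \<Gamma> r = Some (replace \<gamma> U)" using Some by (simp add: defs_Gamma)
      then have "U1 = replace \<theta> U" "U2 = replace \<theta> (replace \<gamma> U)"
        using U1 U2 defs_subst_ctx[OF Some, of \<Theta>] defs_subst_ctx[of \<Gamma> r _ \<Theta>]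
        by (simp_all add: defs_compose apart subst)
      then show ?thesis using \<gamma>[OF w] by (simp add: holds_in_def)
    next
      case None
      then have "defs \<Gamma> r = None" by (simp add: defs_Gamma)
      with None U1 U2 have "U1 = U2"
        by (simp add: defs_compose subst_ctx_def Let_def apart map_add_def)
      then show ?thesis by (simp add: holds_in_def)
    qed
  qed
  \<comment> \<open>\<open>compose\<close> adds no equation of \<Theta>, since both substitutions
    have domain \<open>UV \<Delta>\<close>.\<close>
  have eqs2: "(L, M) \<in> eqs ?D2 \<longleftrightarrow> (\<exists>N. (L, N) \<in> eqs \<Gamma> \<and> M = replace \<theta> N)" for L M
  proof -
    have "H \<in> sdom \<Gamma>" if "(Meta [] H xs, N) \<in> eqs (rename_apart \<Delta> \<Theta>)" for H xs N
    proof -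
      have "H \<in> sdom (rename_apart \<Delta> \<Theta>)" using that unfolding sdom_def by blast
      then show ?thesis by (simp add: dom sdom_Gamma)
    qed
    then show ?thesis by (auto simp: compose_def Let_def apart subst)
  qed
  have lookup2: "lookup ?D2 = map_bodies (replace \<theta>) \<gamma>"
  proof
    fix H
    show "lookup ?D2 H = map_bodies (replace \<theta>) \<gamma> H"
    proof (cases "\<gamma> H")
      case None
      then have "H \<notin> sdom ?D2" by (auto simp: sdom_def eqs2 eqs_Gamma)
      moreover have "map_bodies (replace \<theta>) \<gamma> H = None"
        using None by (simp add: map_bodies_def[of "replace \<theta>"])
      ultimately show ?thesis using lookup_None[of H ?D2] by simp
    next
      case (Some p)
      obtain zs M where p: "p = (zs, M)" by (cases p)
      have "lookup ?D2 H = Some (zs, replace \<theta> M)"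
        by (rule lookup_eqI) (use Some p in \<open>auto simp: eqs2 eqs_Gamma\<close>)
      moreover have "map_bodies (replace \<theta>) \<gamma> H = Some (zs, replace \<theta> M)"
        using Some p by (simp add: map_bodies_def[of "replace \<theta>"])
      ultimately show ?thesis by (simp only:)
    qed
  qed
  have "expand ?D2 k (subst ?D2 (eta_long H)) = expand \<Theta> k (subst \<Theta> (eta_long H))" for H k
  proof -
    let ?H = "eta_long H :: ('b, 'c) trm"
    have w: "wt sig [] (mtag H) ?H (Ty (doms (mty H)) (cod (mty H)))"
      unfolding eta_long_def
      by (rule wt_MetaI) (auto simp: vars_of_types_def distinct_map inj_on_def intro!: nth_equalityI)
    have "subst ?D2 ?H = replace \<theta> (replace \<gamma> ?H)"
      unfolding subst_def lookup2
      by (rule replace_map_bodies[OF wf_gamma wf\<theta> w]) (metis dom\<theta> dom_gamma domIff)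
    then have "expand ?D2 k (subst ?D2 ?H) = expand ?D2 k (replace \<theta> (replace \<gamma> ?H))"
      by (simp only:)
    also have "\<dots> = expand ?D1 k (replace \<theta> (replace \<gamma> ?H))"
      by (rule D12[OF wt_replace[OF wf\<theta> wt_replace[OF wf_gamma w]], symmetric])
    also have "\<dots> = expand ?D1 k (replace \<theta> ?H)"
      by (rule \<gamma>[OF w])
    \<comment> \<open>\<open>eta_long H\<close> contains no recursion constants, so instantiating
      with the raised bodies is raising the instance. \<open>?D1\<close> holds a raised copy of
      \<Theta>'s definitions and hence expands it as \<Theta> does.\<close>
    also have "replace \<theta> ?H = map_rcs ?g (subst \<Theta> ?H)"
      by (simp only: subst_def map_rcs_replace \<theta>_def) (simp add: eta_long_def)
    also have "expand ?D1 k \<dots> = expand \<Theta> k (subst \<Theta> ?H)"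
    proof (rule expand_subst_ctx_raise[OF wf sub])
      have "rcs (subst \<Theta> ?H) \<subseteq> rcs ?H \<union> dom (defs \<Theta>)"
        unfolding subst_def using rcs_lookup[OF sub] by (rule rcs_replace)
      then show "rcs (subst \<Theta> ?H) \<subseteq> dom (defs \<Theta>)" by (simp add: eta_long_def)
    qed
    finally show ?thesis .
  qed
  moreover have "sdom ?D2 = sdom \<Theta>"
    using dom_gamma unfolding dom dom_lookup[of ?D2, symmetric] lookup2
    by (auto simp: map_bodies_def[of "replace \<theta>"] dom_def)
  ultimately show ?thesis
    using sub by (auto simp: more_general_def subst_eq_def)
qed

end

theorem theorem3p11:
  fixes sig :: "'c \<Rightarrow> 'b ty" and \<Delta> \<Gamma> :: "('b, 'c) ctx"
  assumes "wf_ctx sig \<Delta>"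
    and "saturated \<Delta>"
    and "\<not> contra \<Delta>"
    and "unif \<Delta> \<Gamma>"
  shows "most_general_unifier sig \<Delta> \<Gamma>"
proof -
  from assms(4) obtain \<rho> R n where choice: "unif_choice \<Delta> \<rho> R"
    and \<Gamma>: "\<Gamma> = (replace_round \<rho> ^^ n) (unif_start \<Delta> \<rho>)"
      "\<forall>(L, M)\<in>eqs \<Gamma>. mvs M \<subseteq> R" "\<forall>U\<in>ran (defs \<Gamma>). mvs U \<subseteq> R"
    unfolding unif_def by blast
  interpret unified sig \<Delta> \<rho> R n \<Gamma>
    using assms(1-3) choice \<Gamma> by unfold_locales
  show ?thesis
    unfolding most_general_unifier_def using unifier_Gamma more_general_Gamma by blast
qed

end
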